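(* Let $I=[0,1]$. (i) If $f:I\to I$ is continuous and $(I,f)$ is topologically transitive, then $h(\tilde f)=h(\bar f)=\infty$, where $\bar f$ is the induced map on $(\mathcal K(I),D_I)$ and $\tilde f$ is the induced map on $(\mathcal F(I),d_E)$. (ii) There exists a sequence $f_{0,\infty}=\{f_n\}_{n=0}^\infty$ of continuous maps $f_n:I\to I$ such that $(I,f_{0,\infty})$ is topologically transitive but $h(\tilde f_{0,\infty})=h(\bar f_{0,\infty})=0$.
   Context: Non-autonomous systems: for a sequence $f_{0,\infty}=\{f_n\}_{n\ge 0}$ of continuous self-maps of a compact metric space $(X,d)$, $f_0^0=\mathrm{id}$ and $f_0^n=f_{n-1}\circ\cdots\circ f_0$ for $n\ge1$. A single map $f$ corresponds to the constant sequence $f_n=f$. $(X,f_{0,\infty})$ is topologically transitive if for all nonempty open $U,V\subset X$ there is $n\ge1$ with $f_0^n(U)\cap V\neq\emptyset$. Topological entropy: for $n\ge1$, $\epsilon>0$, a set $E\subset X$ is $(n,\epsilon)$-separated if for all $x\ne y$ in $E$ there is $0\le k\le n-1$ with $d(f_0^k(x),f_0^k(y))>\epsilon$. Let $s_n(\epsilon,X,f_{0,\infty})$ be the maximal cardinality of an $(n,\epsilon)$-separated subset of $X$; $h(f_{0,\infty})=\lim_{\epsilon\to0}\limsup_{n\to\infty}\frac1n\log s_n(\epsilon,X,f_{0,\infty})\in[0,+\infty]$. Hyperspace: $\mathcal K(X)$ is the set of nonempty compact subsets of $X$ with the Hausdorff metric $D_X$; $\bar f_{0,\infty}=\{\bar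 f_n\}_{n\ge0}$ with $\bar f_n(A)=f_n(A)$. Fuzzy sets: $\mathcal F(X)$ is the set of all upper semicontinuous $u:X\to[0,1]$; $\tilde f_{0,\infty}=\{\tilde f_n\}_{n\ge0}$, where $\tilde f_n(u)(x)=\sup_{z\in f_n^{-1}(x)}u(z)$ if $f_n^{-1}(x)\neq\emptyset$ and $\tilde f_n(u)(x)=0$ otherwise. With $end(u)=\{(x,a)\in X\times [0,1]:u(x)\ge a\}$, $X\times [0,1]$ carrying the max product metric and $D_{X\times [0,1]}$ the Hausdorff metric on its nonempty compact subsets, the endograph metric is $d_E(u,v)=D_{X\times [0,1]}(end(u),end(v))$ for $u,v$ not identically zero; for the empty fuzzy set $\emptyset_X\equiv0$, $d_E(\emptyset_X,\emptyset_X)=0$ and $d_E(\emptyset_X,u)$ is the Hausdorff distance between the parts of $end(\emptyset_X)$ and $end(u)$ lying in $\mathrm{supp}(u)\times [0,1]$, where $\mathrm{supp}(u)=\overline{\{x:u(x)>0\}}$. $(\mathcal F(X),d_E)$ is a compact metric space. Entropies of the induced systems: $h(\bar f_{0,\infty})=\lim_{\epsilon\to0}\limsup_{n\to\infty}\frac1n\log s_n(\epsilon,\mathcal K(X),\bar f_{0,\infty})$, where $s_n(\epsilon,\mathcal K(X),\bar f_{0,\infty})$ is the maximal cardinality of a set $E\subset\mathcal K(X)$ such that for all $A\ne B$ in $E$ there is $0\le k\le n-1$ with $D_X(\bar f_0^k(A),\bar f_0^k(B))>\epsilon$; and $h(\tilde f_{0,\infty})=\lim_{\epsilon\to0}\limsup_{n\to\infty}\frac1n\log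 s_n(\epsilon,\mathcal F(X),\tilde f_{0,\infty})$, where $s_n(\epsilon,\mathcal F(X),\tilde f_{0,\infty})$ is the maximal cardinality of a set $E\subset\mathcal F(X)$ such that for all $u\ne v$ in $E$ there is $0\le k\le n-1$ with $d_E(\tilde f_0^k(u),\tilde f_0^k(v))>\epsilon$. Here $\bar f_0^0$ and $\tilde f_0^0$ are identity maps, $\bar f_0^k=\bar f_{k-1}\circ\cdots\circ\bar f_0$ and $\tilde f_0^k=\tilde f_{k-1}\circ\cdots\circ\tilde f_0$ for $k\ge1$. *)

theory Defs
  imports "HOL-Analysis.Analysis"
begin

section \<open>Non-autonomous systems on a carrier set\<close>

text \<open>
  All spaces are carrier sets inside a type, so that the same notion of entropy applies to the
  base space, to the hyperspace of compact sets and to the space of fuzzy sets.  A sequence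
  \<open>f\<close> of maps is only looked at on its carrier.
\<close>

primrec nds_iter :: "(nat \<Rightarrow> 'a \<Rightarrow> 'a) \<Rightarrow> nat \<Rightarrow> 'a \<Rightarrow> 'a" where
  "nds_iter f 0 = id"
| "nds_iter f (Suc n) = f n \<circ> nds_iter f n"

definition self_map_on :: "'a::metric_space set \<Rightarrow> ('a \<Rightarrow> 'a) \<Rightarrow> bool" where
  "self_map_on X g \<longleftrightarrow> continuous_on X g \<and> g \<in> X \<rightarrow> X"

definition nds_transitive :: "'a::metric_space set \<Rightarrow> (nat \<Rightarrow> 'a \<Rightarrow> 'a) \<Rightarrow> bool" where
  "nds_transitive X f \<longleftrightarrow>
     (\<forall>U V. openin (top_of_set X) U \<and> U \<noteq> {} \<and> openin (top_of_set X) V \<and> V \<noteq> {} \<longrightarrow>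
        (\<exists>n\<ge>1. nds_iter f n ` U \<inter> V \<noteq> {}))"

section \<open>Topological entropy\<close>

definition nds_separated ::
    "('a \<Rightarrow> 'a \<Rightarrow> real) \<Rightarrow> (nat \<Rightarrow> 'a \<Rightarrow> 'a) \<Rightarrow> nat \<Rightarrow> real \<Rightarrow> 'a set \<Rightarrow> bool" where
  "nds_separated d f n \<epsilon> E \<longleftrightarrow>
     (\<forall>x\<in>E. \<forall>y\<in>E. x \<noteq> y \<longrightarrow> (\<exists>k<n. d (nds_iter f k x) (nds_iter f k y) > \<epsilon>))"

text \<open>
  The supremum over the finite separated sets is the maximal cardinality of a separated set:
  an infinite separated set has finite separated subsets of every size, and then the value
  is \<open>\<infinity>\<close> (which does not happen for continuous maps of a compact space).
\<close>

definition sep_number ::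
    "'a set \<Rightarrow> ('a \<Rightarrow> 'a \<Rightarrow> real) \<Rightarrow> (nat \<Rightarrow> 'a \<Rightarrow> 'a) \<Rightarrow> nat \<Rightarrow> real \<Rightarrow> enat" where
  "sep_number M d f n \<epsilon> =
     (SUP E\<in>{E. E \<subseteq> M \<and> finite E \<and> nds_separated d f n \<epsilon> E}. enat (card E))"

definition ln_enat :: "enat \<Rightarrow> ereal" where
  "ln_enat m = (case m of enat k \<Rightarrow> ereal (ln (real k)) | \<infinity> \<Rightarrow> \<infinity>)"

definition nds_entropy ::
    "'a set \<Rightarrow> ('a \<Rightarrow> 'a \<Rightarrow> real) \<Rightarrow> (nat \<Rightarrow> 'a \<Rightarrow> 'a) \<Rightarrow> ereal" where
  "nds_entropy M d f =
     Lim (at_right 0) (\<lambda>\<epsilon>. limsup (\<lambda>n. ereal (1 / real n) * ln_enat (sep_number M d f n \<epsilon>)))"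

section \<open>The hyperspace of nonempty compact sets\<close>

text \<open>
  Only meaningful for nonempty bounded sets.  The distance function is a parameter because the
  type class distance on products is the Euclidean one, whereas endographs are compared in the
  maximum distance.
\<close>

definition hausdorff_dist :: "('a \<Rightarrow> 'a \<Rightarrow> real) \<Rightarrow> 'a set \<Rightarrow> 'a set \<Rightarrow> real" where
  "hausdorff_dist d A B =
     max (SUP a\<in>A. INF b\<in>B. d a b) (SUP b\<in>B. INF a\<in>A. d a b)"

definition hyperspace :: "'a::metric_space set \<Rightarrow> 'a set set" where
  "hyperspace X = {A. A \<subseteq> X \<and> A \<noteq> {} \<and> compact A}"

definition hyper_map :: "('a \<Rightarrow> 'a) \<Rightarrow> 'a set \<Rightarrow> 'a set" where
  "hyper_map g A = g ` A"

definition hyper_entropy :: "'a::metric_space set \<Rightarrow> (nat \<Rightarrow> 'a \<Rightarrow> 'a) \<Rightarrow> ereal" where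
  "hyper_entropy X f =
     nds_entropy (hyperspace X) (hausdorff_dist dist) (\<lambda>n. hyper_map (f n))"

section \<open>Fuzzy sets with the endograph metric\<close>

text \<open>
  A fuzzy set on \<open>X\<close> is a function on \<open>X\<close>; it is represented by its extension that is
  \<open>undefined\<close> off \<open>X\<close>, so that distinct elements differ on \<open>X\<close>.
\<close>

definition fuzzy_sets :: "'a::metric_space set \<Rightarrow> ('a \<Rightarrow> real) set" where
  "fuzzy_sets X =
     {u \<in> X \<rightarrow>\<^sub>E {0..1}. \<forall>a. openin (top_of_set X) {x \<in> X. u x < a}}"

definition fuzzy_map :: "'a set \<Rightarrow> ('a \<Rightarrow> 'a) \<Rightarrow> ('a \<Rightarrow> real) \<Rightarrow> 'a \<Rightarrow> real" where
  "fuzzy_map X g u =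
     (\<lambda>x\<in>X. if \<exists>z\<in>X. g z = x then SUP z\<in>{z \<in> X. g z = x}. u z else 0)"

definition endograph :: "'a set \<Rightarrow> ('a \<Rightarrow> real) \<Rightarrow> ('a \<times> real) set" where
  "endograph X u = {(x, a). x \<in> X \<and> a \<in> {0..1} \<and> u x \<ge> a}"

definition fuzzy_supp :: "'a::metric_space set \<Rightarrow> ('a \<Rightarrow> real) \<Rightarrow> 'a set" where
  "fuzzy_supp X u = X \<inter> closure {x \<in> X. u x > 0}"

definition max_dist :: "'a::metric_space \<times> real \<Rightarrow> 'a \<times> real \<Rightarrow> real" where
  "max_dist p q = max (dist (fst p) (fst q)) (dist (snd p) (snd q))"

definition fuzzy_empty :: "'a set \<Rightarrow> ('a \<Rightarrow> real) \<Rightarrow> bool" where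
  "fuzzy_empty X u \<longleftrightarrow> (\<forall>x\<in>X. u x = 0)"

definition endo_dist ::
    "'a::metric_space set \<Rightarrow> ('a \<Rightarrow> real) \<Rightarrow> ('a \<Rightarrow> real) \<Rightarrow> real" where
  "endo_dist X u v =
     (if fuzzy_empty X u \<and> fuzzy_empty X v then 0
      else if fuzzy_empty X u then
        hausdorff_dist max_dist (endograph X u \<inter> fuzzy_supp X v \<times> {0..1})
          (endograph X v \<inter> fuzzy_supp X v \<times> {0..1})
      else if fuzzy_empty X v then
        hausdorff_dist max_dist (endograph X u \<inter> fuzzy_supp X u \<times> {0..1})
          (endograph X v \<inter> fuzzy_supp X u \<times> {0..1})
      else hausdorff_dist max_dist (endograph X u) (endograph X v))"

definition fuzzy_entropy :: "'a::metric_space set \<Rightarrow> (nat \<Rightarrow> 'a \<Rightarrow> 'a) \<Rightarrow> ereal" where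
  "fuzzy_entropy X f =
     nds_entropy (fuzzy_sets X) (endo_dist X) (\<lambda>n. fuzzy_map X (f n))"

end

theory Submission
  imports Defs "HOL-Library.Discrete_Functions" "HOL-Real_Asymp.Real_Asymp"
begin

text \<open>
  (i) A fixed point \<open>p\<close> in the interior of the interval either has another interior preimage, or
  \<open>f\<close> swaps the two sides of \<open>p\<close>; in the second case \<open>f\<^sup>2\<close> is transitive on the left side, fixes
  its endpoint \<open>p\<close> and so cannot swap the sides of its own interior fixed point. Hence a fixed point
  of \<open>f\<close> or of \<open>f\<^sup>2\<close> has a homoclinic point, and some \<open>f\<^sup>m\<close> has a horseshoe. Then \<open>f\<^sup>m\<^sup>k\<close> has
  \<open>2\<^sup>k\<close> disjoint compact pieces, each covering all of them, and a compact set may visit an arbitrary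
  nonempty set of pieces at each step. This gives \<open>h \<ge> ln (2 ^ 2\<^sup>k - 1) / (m k)\<close> for the
  hyperspace map, which is unbounded in \<open>k\<close>; indicator functions transfer it to fuzzy sets.

  (ii) Apply a transitive map only at the times just before a square, and the identity otherwise.
  Only about \<open>\<surd>n\<close> distinct iterates occur up to time \<open>n\<close>, and as the space of fuzzy sets is
  totally bounded, separated sets have at most \<open>C powr (\<surd>n + 1)\<close> elements.
\<close>

section \<open>Entropy\<close>

lemma nds_iter_const: "nds_iter (\<lambda>_. g) n = g ^^ n"
  by (induction n) auto

lemma nds_iter_hyper_map: "nds_iter (\<lambda>n. hyper_map (f n)) n A = nds_iter f n ` A"
  by (induction n) (auto simp: hyper_map_def image_comp)

lemma nds_iter_in:
  assumes "\<And>n x. x \<in> M \<Longrightarrow> f n x \<in> M" "x \<in> M"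
  shows "nds_iter f n x \<in> M"
  using assms by (induction n) auto

text \<open>The growth rate at a fixed scale. Everything below is proved at this level, before
  \<epsilon> tends to 0.\<close>

definition entropy_rate ::
    "'a set \<Rightarrow> ('a \<Rightarrow> 'a \<Rightarrow> real) \<Rightarrow> (nat \<Rightarrow> 'a \<Rightarrow> 'a) \<Rightarrow> real \<Rightarrow> ereal" where
  "entropy_rate M d f \<epsilon> = limsup (\<lambda>n. ereal (1 / real n) * ln_enat (sep_number M d f n \<epsilon>))"

lemma ln_enat_nonneg: "0 \<le> ln_enat m"
proof (cases m)
  case (enat k)
  \<comment> \<open>The split isolates \<open>k = 0\<close>, where \<open>ln 0 = 0\<close> is a
    convention.\<close>
  then show ?thesis by (cases k) (auto simp: ln_enat_def)
qed (simp add: ln_enat_def)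

lemma ln_enat_mono:
  assumes "m \<le> m'"
  shows "ln_enat m \<le> ln_enat m'"
proof (cases m')
  case (enat k')
  with assms obtain k where "m = enat k" "k \<le> k'"
    by (cases m) auto
  then show ?thesis
    using enat ln_enat_nonneg[of m'] by (cases k) (auto simp: ln_enat_def)
qed (simp add: ln_enat_def)

lemma card_le_sep_number:
  assumes "E \<subseteq> M" "finite E" "nds_separated d f n \<epsilon> E"
  shows "enat (card E) \<le> sep_number M d f n \<epsilon>"
  unfolding sep_number_def using assms by (intro SUP_upper) auto

lemma sep_number_le:
  assumes "\<And>E. E \<subseteq> M \<Longrightarrow> finite E \<Longrightarrow> nds_separated d f n \<epsilon> E \<Longrightarrow> enat (card E) \<le> N"
  shows "sep_number M d f n \<epsilon> \<le> N"
  unfolding sep_number_def using assms by (intro SUP_least) auto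

lemma nds_separated_antimono:
  assumes "nds_separated d f n \<epsilon>' E" "\<epsilon> \<le> \<epsilon>'"
  shows "nds_separated d f n \<epsilon> E"
  using assms unfolding nds_separated_def by (meson le_less_trans)

text \<open>The two systems may live on different spaces, so this serves both monotonicity in
  \<epsilon> and the comparison of compact sets with fuzzy sets.\<close>

lemma entropy_rate_mono:
  assumes "\<And>n. sep_number M d f n \<epsilon> \<le> sep_number M' d' f' n \<epsilon>'"
  shows "entropy_rate M d f \<epsilon> \<le> entropy_rate M' d' f' \<epsilon>'"
  unfolding entropy_rate_def using assms
  by (intro Limsup_mono always_eventually allI ereal_mult_left_mono ln_enat_mono) auto

lemma entropy_rate_antimono:
  assumes "\<epsilon> \<le> \<epsilon>'"
  shows "entropy_rate M d f \<epsilon>' \<le> entropy_rate M d f \<epsilon>"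
  using assms
  by (intro entropy_rate_mono sep_number_le card_le_sep_number)
     (auto intro: nds_separated_antimono)

lemma entropy_rate_nonneg: "0 \<le> entropy_rate M d f \<epsilon>"
  unfolding entropy_rate_def
  by (intro le_Limsup always_eventually allI ereal_0_le_mult) (auto simp: ln_enat_nonneg)

text \<open>The rate grows as \<epsilon> shrinks, so exceeding \<open>r\<close> at one scale means
  exceeding it at all smaller ones.\<close>

lemma nds_entropy_eq_infinity:
  assumes "\<And>r. \<exists>\<epsilon>>0. ereal r < entropy_rate M d f \<epsilon>"
  shows "nds_entropy M d f = \<infinity>"
proof -
  have "(entropy_rate M d f \<longlongrightarrow> \<infinity>) (at_right 0)"
    unfolding tendsto_PInfty
  proof
    fix r
    obtain \<epsilon> where \<epsilon>: "\<epsilon> > 0" "ereal r < entropy_rate M d f \<epsilon>"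
      using assms by blast
    show "\<forall>\<^sub>F x in at_right 0. ereal r < entropy_rate M d f x"
      unfolding eventually_at_right_field using \<epsilon> entropy_rate_antimono
      by (meson less_imp_le less_le_trans)
  qed
  then show ?thesis
    unfolding nds_entropy_def entropy_rate_def[symmetric, abs_def]
    by (intro tendsto_Lim) auto
qed

lemma nds_entropy_eq_0:
  assumes "\<And>\<epsilon>. \<epsilon> > 0 \<Longrightarrow> entropy_rate M d f \<epsilon> \<le> 0"
  shows "nds_entropy M d f = 0"
proof -
  have "(entropy_rate M d f \<longlongrightarrow> 0) (at_right 0)"
    by (intro tendsto_eventually) (auto simp: eventually_at_right_field entropy_rate_nonneg assms
        intro!: exI[of _ 1] antisym)
  then show ?thesis
    unfolding nds_entropy_def entropy_rate_def[symmetric, abs_def]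
    by (intro tendsto_Lim) auto
qed

section \<open>Hausdorff distances and characteristic functions\<close>

text \<open>A single point of \<open>A\<close> far from \<open>B\<close> forces a large distance.
  The bounds on \<open>d\<close> are there because real suprema and infima are meaningful only for
  bounded families.\<close>

lemma hausdorff_dist_ge:
  assumes "a \<in> A" "B \<noteq> {}" "\<And>b. b \<in> B \<Longrightarrow> \<delta> \<le> d a b"
    and bd: "\<And>a b. a \<in> A \<Longrightarrow> b \<in> B \<Longrightarrow> 0 \<le> d a b \<and> d a b \<le> D"
  shows "\<delta> \<le> hausdorff_dist d A B"
proof -
  obtain b0 where b0: "b0 \<in> B" using assms by blast
  have bb: "bdd_below (d a' ` B)" if "a' \<in> A" for a'
    using bd that by (intro bdd_belowI2[of _ 0]) auto
  have "(INF b\<in>B. d a' b) \<le> D" if "a' \<in> A" for a'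
    using cINF_lower[OF bb[OF that] b0] bd[OF that b0] by linarith
  then have ba: "bdd_above ((\<lambda>a. INF b\<in>B. d a b) ` A)"
    by (intro bdd_aboveI2)
  have "\<delta> \<le> (INF b\<in>B. d a b)"
    using assms by (intro cINF_greatest) auto
  also have "\<dots> \<le> (SUP a\<in>A. INF b\<in>B. d a b)"
    by (intro cSUP_upper assms ba)
  finally show ?thesis unfolding hausdorff_dist_def by simp
qed

lemma hausdorff_dist_flip: "hausdorff_dist d A B = hausdorff_dist (\<lambda>x y. d y x) B A"
  unfolding hausdorff_dist_def by (simp add: max.commute)

lemma hausdorff_dist_le:
  assumes "A \<noteq> {}" "B \<noteq> {}"
    and "\<And>a. a \<in> A \<Longrightarrow> \<exists>b\<in>B. d a b \<le> \<delta>" "\<And>b. b \<in> B \<Longrightarrow> \<exists>a\<in>A. d a b \<le> \<delta>"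
    and nn: "\<And>a b. 0 \<le> d a b"
  shows "hausdorff_dist d A B \<le> \<delta>"
proof -
  have "(INF b\<in>B. d a b) \<le> \<delta>" if a: "a \<in> A" for a
  proof -
    obtain b where "b \<in> B" "d a b \<le> \<delta>" using assms a by blast
    then show ?thesis using nn by (intro cINF_lower2[of _ _ b]) (auto intro: bdd_belowI2[of _ 0])
  qed
  moreover have "(INF a\<in>A. d a b) \<le> \<delta>" if b: "b \<in> B" for b
  proof -
    obtain a where "a \<in> A" "d a b \<le> \<delta>" using assms b by blast
    then show ?thesis using nn by (intro cINF_lower2[of _ _ a]) (auto intro: bdd_belowI2[of _ 0])
  qed
  ultimately show ?thesis
    unfolding hausdorff_dist_def using assms(1,2) by (auto intro!: cSUP_least)
qed

text \<open>A partial converse of \<open>hausdorff_dist_ge\<close>. The margin \<delta> is uniform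
  in the other set (it can be the infimum itself), because pointwise strict inequalities would not
  survive an infimum.\<close>

lemma hausdorff_dist_greater_cases:
  assumes "\<epsilon> < hausdorff_dist dist A B" "A \<noteq> {}" "B \<noteq> {}"
    and bd: "\<And>a b. a \<in> A \<Longrightarrow> b \<in> B \<Longrightarrow> dist a b \<le> D"
  obtains a \<delta> where "a \<in> A" "\<epsilon> < \<delta>" "\<And>b. b \<in> B \<Longrightarrow> \<delta> \<le> dist a b"
  | b \<delta> where "b \<in> B" "\<epsilon> < \<delta>" "\<And>a. a \<in> A \<Longrightarrow> \<delta> \<le> dist a b"
proof -
  have *: "\<exists>a\<in>A. \<exists>\<delta>>\<epsilon>. \<forall>b\<in>B. \<delta> \<le> d a b"
    if "\<epsilon> < (SUP a\<in>A. INF b\<in>B. d a b)" "A \<noteq> {}" and "\<And>a b. 0 \<le> d a b"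
    for A B :: "'a set" and d :: "'a \<Rightarrow> 'a \<Rightarrow> real"
  proof (rule ccontr)
    assume n: "\<not> ?thesis"
    have "(INF b\<in>B. d a b) \<le> \<epsilon>" if "a \<in> A" for a
    proof (rule ccontr)
      assume "\<not> (INF b\<in>B. d a b) \<le> \<epsilon>"
      moreover have "\<forall>b\<in>B. (INF b\<in>B. d a b) \<le> d a b"
        using \<open>\<And>a b. 0 \<le> d a b\<close> by (auto intro!: cINF_lower bdd_belowI2[of _ 0])
      ultimately show False using n \<open>a \<in> A\<close> by force
    qed
    then have "(SUP a\<in>A. INF b\<in>B. d a b) \<le> \<epsilon>"
      using \<open>A \<noteq> {}\<close> by (intro cSUP_least) auto
    with that show False by simp
  qed
  from assms(1) consider "\<epsilon> < (SUP a\<in>A. INF b\<in>B. dist a b)" | "\<epsilon> < (SUP b\<in>B. INF a\<in>A. dist a b)"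
    unfolding hausdorff_dist_def by (auto simp: less_max_iff_disj)
  then show thesis
  proof cases
    case 1 then show ?thesis using *[OF 1 assms(2)] that(1) by auto
  next
    case 2 then show ?thesis using *[where A=B and B=A and d="\<lambda>b a. dist a b"] assms(3) that(2) by auto
  qed
qed

section \<open>Compact sets embedded in the fuzzy sets\<close>

definition fuzzy_indicator :: "'a set \<Rightarrow> 'a set \<Rightarrow> 'a \<Rightarrow> real" where
  "fuzzy_indicator X A = restrict (indicator A) X"

text \<open>The sets where an indicator is below \<open>a\<close> are empty, the complement of
  \<open>A\<close>, or everything; closedness of \<open>A\<close> handles the middle case.\<close>

lemma fuzzy_indicator_in_fuzzy_sets:
  assumes "closed A" "A \<subseteq> X"
  shows "fuzzy_indicator X A \<in> fuzzy_sets X"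
proof -
  have "openin (top_of_set X) {x \<in> X. fuzzy_indicator X A x < a}" for a
  proof -
    consider "a \<le> 0" | "0 < a" "a \<le> 1" | "1 < a" by linarith
    then show ?thesis
    proof cases
      case 1
      then have "{x \<in> X. fuzzy_indicator X A x < a} = {}"
        by (auto simp: fuzzy_indicator_def indicator_def)
      then show ?thesis by (simp only: openin_empty)
    next
      case 2
      then have "{x \<in> X. fuzzy_indicator X A x < a} = X \<inter> - A"
        by (auto simp: fuzzy_indicator_def indicator_def split: if_splits)
      then show ?thesis using assms by (auto intro!: openin_open_Int)
    next
      case 3
      then have "{x \<in> X. fuzzy_indicator X A x < a} = X"
        by (auto simp: fuzzy_indicator_def indicator_def)
      then show ?thesis by simp
    qed
  qed
  then show ?thesis
    by (auto simp: fuzzy_sets_def fuzzy_indicator_def indicator_def)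
qed

text \<open>A supremum of values 0 and 1 over a fibre is 1 exactly when the fibre meets
  \<open>A\<close>. Thus indicators intertwine the hyperspace map with the fuzzy map.\<close>

lemma fuzzy_map_indicator:
  assumes "A \<subseteq> X"
  shows "fuzzy_map X g (fuzzy_indicator X A) = fuzzy_indicator X (g ` A)"
proof
  fix x
  show "fuzzy_map X g (fuzzy_indicator X A) x = fuzzy_indicator X (g ` A) x"
  proof (cases "x \<in> X \<and> (\<exists>z\<in>X. g z = x)")
    case True
    let ?Z = "{z \<in> X. g z = x}"
    have ne: "?Z \<noteq> {}" using True by blast
    have "(SUP z\<in>?Z. fuzzy_indicator X A z) = indicator (g ` A) x"
    proof (cases "x \<in> g ` A")
      case in_image: True
      then obtain z where z: "z \<in> A" "g z = x" by blast
      have "fuzzy_indicator X A z \<le> (SUP z\<in>?Z. fuzzy_indicator X A z)"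
        using z assms by (intro cSUP_upper bdd_aboveI2[of _ _ 1])
          (auto simp: fuzzy_indicator_def indicator_def)
      moreover have "(SUP z\<in>?Z. fuzzy_indicator X A z) \<le> 1"
        using ne by (intro cSUP_least) (auto simp: fuzzy_indicator_def indicator_def)
      ultimately show ?thesis using z assms in_image by (auto simp: fuzzy_indicator_def)
    next
      case False
      then have "(SUP z\<in>?Z. fuzzy_indicator X A z) = (SUP z\<in>?Z. 0)"
        by (intro SUP_cong) (auto simp: fuzzy_indicator_def indicator_def)
      then show ?thesis using False ne by auto
    qed
    then show ?thesis using True by (auto simp: fuzzy_map_def fuzzy_indicator_def)
  next
    case False
    then show ?thesis using assms by (auto simp: fuzzy_map_def fuzzy_indicator_def indicator_def)
  qed
qed

lemma max_dist_bounds: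
  assumes "p \<in> {0..1::real} \<times> {0..1}" "q \<in> {0..1} \<times> {0..1}"
  shows "0 \<le> max_dist p q \<and> max_dist p q \<le> (1::real)"
  using assms by (auto simp: max_dist_def dist_real_def)

text \<open>A point of the endograph either lies above \<open>B\<close>, and is horizontally far
  from \<open>a\<close>, or has height 0, and is vertically at distance 1 from the peak
  \<open>(a, 1)\<close>.\<close>

lemma endograph_indicator_far:
  assumes "a \<in> {0..1}" "B \<subseteq> {0..1::real}" "\<And>b. b \<in> B \<Longrightarrow> \<delta> \<le> dist a b" "\<delta> \<le> 1"
    and "q \<in> endograph {0..1} (fuzzy_indicator {0..1} B)"
  shows "\<delta> \<le> max_dist (a, 1) q"
proof (cases "fst q \<in> B")
  case True
  then show ?thesis using assms by (force simp: max_dist_def)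
next
  case False
  then have "snd q = 0" using assms(5)
    by (auto simp: endograph_def fuzzy_indicator_def)
  then show ?thesis using assms(4) by (simp add: max_dist_def)
qed

lemma endo_dist_indicator_gt:
  assumes A: "A \<subseteq> {0..1::real}" "A \<noteq> {}" and B: "B \<subseteq> {0..1}" "B \<noteq> {}"
    and "\<epsilon> < hausdorff_dist dist A B"
  shows "\<epsilon> < endo_dist {0..1} (fuzzy_indicator {0..1} A) (fuzzy_indicator {0..1} B)"
proof -
  let ?e = "\<lambda>A. endograph {0..1} (fuzzy_indicator {0..1} A)"
  have mem: "(a, 1) \<in> ?e C" if "a \<in> C" "C \<subseteq> {0..1}" for a C
    using that by (auto simp: endograph_def fuzzy_indicator_def)
  have sub: "?e C \<subseteq> {0..1} \<times> {0..1}" for C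
    by (auto simp: endograph_def)
  have ne: "\<not> fuzzy_empty {0..1} (fuzzy_indicator {0..1} C)" "?e C \<noteq> {}"
    if "C \<subseteq> {0..1}" "C \<noteq> {}" for C
  proof -
    from that obtain c where c: "c \<in> C" "c \<in> {0..1}" by blast
    then show "\<not> fuzzy_empty {0..1} (fuzzy_indicator {0..1} C)"
      unfolding fuzzy_empty_def by (intro notI) (drule bspec[of _ _ c], auto simp: fuzzy_indicator_def)
    show "?e C \<noteq> {}" using mem[of c C] c that by blast
  qed
  have le1: "dist a b \<le> 1" if "a \<in> A" "b \<in> B" for a b
    using that A B by (force simp: dist_real_def)
  have "\<epsilon> < hausdorff_dist max_dist (?e A) (?e B)"
    using assms(5) A(2) B(2) le1
  proof (rule hausdorff_dist_greater_cases)
    fix a \<delta> assume a: "a \<in> A" "\<epsilon> < \<delta>" "\<And>b. b \<in> B \<Longrightarrow> \<delta> \<le> dist a b"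
    \<comment> \<open>The margin cannot exceed the diameter of the interval, so the vertical
      distance 1 suffices as well.\<close>
    have "\<delta> \<le> 1" using a(1,3) B(2) le1 by (meson ex_in_conv order_trans)
    with a have "\<delta> \<le> hausdorff_dist max_dist (?e A) (?e B)"
      using A B by (intro hausdorff_dist_ge[of "(a, 1)" _ _ _ _ 1] mem ne endograph_indicator_far
          max_dist_bounds[OF subsetD[OF sub] subsetD[OF sub]]) auto
    with a show ?thesis by simp
  next
    fix b \<delta> assume b: "b \<in> B" "\<epsilon> < \<delta>" "\<And>a. a \<in> A \<Longrightarrow> \<delta> \<le> dist a b"
    have "\<delta> \<le> 1" using b(1,3) A(2) le1 by (meson ex_in_conv order_trans)
    with b have "\<delta> \<le> hausdorff_dist max_dist (?e B) (?e A)"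
      using A B by (intro hausdorff_dist_ge[of "(b, 1)" _ _ _ _ 1] mem ne endograph_indicator_far
          max_dist_bounds[OF subsetD[OF sub] subsetD[OF sub]]) (auto simp: dist_commute)
    also have "\<dots> = hausdorff_dist max_dist (?e A) (?e B)"
      by (subst hausdorff_dist_flip) (simp add: max_dist_def[abs_def] dist_commute)
    finally show ?thesis using b by simp
  qed
  then show ?thesis using ne(1)[OF A] ne(1)[OF B] by (simp add: endo_dist_def)
qed

lemma inj_on_fuzzy_indicator: "inj_on (fuzzy_indicator X) (Pow X)"
proof (rule inj_onI)
  fix A B assume "A \<in> Pow X" "B \<in> Pow X" and eq: "fuzzy_indicator X A = fuzzy_indicator X B"
  moreover have "x \<in> A \<longleftrightarrow> x \<in> B" if "x \<in> X" for x
    using fun_cong[OF eq, of x] that by (auto simp: fuzzy_indicator_def indicator_def split: if_splits)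
  ultimately show "A = B" by blast
qed

text \<open>Indicators carry separated families of compact sets to separated families of fuzzy sets
  of the same size. This lifts infinite entropy to fuzzy sets in (i) and brings zero entropy down to
  compact sets in (ii).\<close>

lemma hyper_rate_le_fuzzy_rate:
  assumes "\<And>n. f n \<in> {0..1} \<rightarrow> {0..1::real}"
  shows "entropy_rate (hyperspace {0..1}) (hausdorff_dist dist) (\<lambda>n. hyper_map (f n)) \<epsilon>
         \<le> entropy_rate (fuzzy_sets {0..1}) (endo_dist {0..1}) (\<lambda>n. fuzzy_map {0..1} (f n)) \<epsilon>"
proof (intro entropy_rate_mono sep_number_le)
  fix n E
  assume E: "E \<subseteq> hyperspace {0..1::real}" "finite E"
    "nds_separated (hausdorff_dist dist) (\<lambda>n. hyper_map (f n)) n \<epsilon> E"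
  let ?\<chi> = "fuzzy_indicator {0..1::real}"
  have iter_sub: "nds_iter f k ` A \<subseteq> {0..1}" if "A \<subseteq> {0..1}" for k A
    using nds_iter_in[of "{0..1}" f] assms that by blast
  have iter: "nds_iter (\<lambda>n. fuzzy_map {0..1} (f n)) k (?\<chi> A) = ?\<chi> (nds_iter f k ` A)"
    if "A \<subseteq> {0..1}" for k A
    by (induction k) (use that iter_sub in \<open>auto simp: fuzzy_map_indicator image_comp\<close>)
  have "enat (card (?\<chi> ` E)) \<le> sep_number (fuzzy_sets {0..1}) (endo_dist {0..1}) (\<lambda>n. fuzzy_map {0..1} (f n)) n \<epsilon>"
  proof (rule card_le_sep_number)
    show "?\<chi> ` E \<subseteq> fuzzy_sets {0..1}"
      using E by (auto simp: hyperspace_def compact_imp_closed intro!: fuzzy_indicator_in_fuzzy_sets)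
    show "finite (?\<chi> ` E)" using E by simp
    show "nds_separated (endo_dist {0..1}) (\<lambda>n. fuzzy_map {0..1} (f n)) n \<epsilon> (?\<chi> ` E)"
      unfolding nds_separated_def
    proof safe
      fix A B assume AB: "A \<in> E" "B \<in> E" "?\<chi> A \<noteq> ?\<chi> B"
      then obtain k where k: "k < n" "\<epsilon> < hausdorff_dist dist (nds_iter f k ` A) (nds_iter f k ` B)"
        using E(3) unfolding nds_separated_def nds_iter_hyper_map by metis
      have "A \<subseteq> {0..1}" "A \<noteq> {}" "B \<subseteq> {0..1}" "B \<noteq> {}"
        using AB E(1) by (auto simp: hyperspace_def)
      with k show "\<exists>k<n. \<epsilon> < endo_dist {0..1}
          (nds_iter (\<lambda>n. fuzzy_map {0..1} (f n)) k (?\<chi> A))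
          (nds_iter (\<lambda>n. fuzzy_map {0..1} (f n)) k (?\<chi> B))"
        using iter_sub by (intro exI[of _ k]) (simp add: iter endo_dist_indicator_gt)
    qed
  qed
  moreover have "card (?\<chi> ` E) = card E"
    using E(1) by (intro card_image inj_on_subset[OF inj_on_fuzzy_indicator])
      (auto simp: hyperspace_def)
  ultimately show "enat (card E) \<le> sep_number (fuzzy_sets {0..1}) (endo_dist {0..1}) (\<lambda>n. fuzzy_map {0..1} (f n)) n \<epsilon>"
    by simp
qed

section \<open>Horseshoes\<close>

text \<open>Preimages are chosen backwards from the prescribed endpoint \<open>y\<close>; each point
  found lies in some piece, which every piece covers.\<close>

lemma itinerary_exists:
  assumes "\<And>v w. v \<in> W \<Longrightarrow> w \<in> W \<Longrightarrow> J w \<subseteq> g ` J v" "y \<in> J w\<^sub>0" "w\<^sub>0 \<in> W"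
    and "\<And>i. i < N \<Longrightarrow> t i \<in> W"
  shows "\<exists>x. (\<forall>i<N. (g ^^ i) x \<in> J (t i)) \<and> (g ^^ N) x = y"
  using assms(4)
proof (induction N arbitrary: t)
  case 0
  then show ?case by auto
next
  case (Suc N)
  obtain x where x: "\<forall>i<N. (g ^^ i) x \<in> J (t (Suc i))" "(g ^^ N) x = y"
    using Suc.IH[of "\<lambda>i. t (Suc i)"] Suc.prems by auto
  \<comment> \<open>If the remaining itinerary is empty, \<open>x\<close> is \<open>y\<close>
    itself; otherwise \<open>x\<close> lies in the piece named second by \<open>t\<close>.\<close>
  have "\<exists>w\<in>W. x \<in> J w"
  proof (cases N)
    case 0
    then show ?thesis using x assms(2,3) by auto
  next
    case (Suc k)
    then show ?thesis using x(1) Suc.prems[of "Suc 0"] by (intro bexI[of _ "t (Suc 0)"]) auto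
  qed
  then obtain x' where x': "x' \<in> J (t 0)" "x = g x'"
    using assms(1)[of "t 0"] Suc.prems by blast
  have "(g ^^ i) x' \<in> J (t i)" if "i < Suc N" for i
    using that x x' by (cases i) (auto simp del: funpow.simps simp: funpow_Suc_right)
  moreover have "(g ^^ Suc N) x' = y"
    using x x' by (simp del: funpow.simps add: funpow_Suc_right)
  ultimately show ?case by blast
qed

text \<open>
  Every sequence of \<open>N\<close> nonempty subsets of \<open>W\<close> is realised by a finite set, which at time \<open>m i\<close>
  visits exactly the pieces in the \<open>i\<close>-th subset.
\<close>

lemma hyper_sep_number_horseshoe:
  fixes J :: "'w \<Rightarrow> 'a::metric_space set"
  assumes X: "f \<in> X \<rightarrow> X" "bounded X"
    and W: "finite W" "W \<noteq> {}" and J: "\<And>w. w \<in> W \<Longrightarrow> J w \<subseteq> X" "\<And>w. w \<in> W \<Longrightarrow> J w \<noteq> {}"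
    and cov: "\<And>v w. v \<in> W \<Longrightarrow> w \<in> W \<Longrightarrow> J w \<subseteq> (f ^^ m) ` J v"
    and sep: "\<And>v w x y. v \<in> W \<Longrightarrow> w \<in> W \<Longrightarrow> v \<noteq> w \<Longrightarrow> x \<in> J v \<Longrightarrow> y \<in> J w \<Longrightarrow> \<delta> \<le> dist x y"
    and "\<epsilon> < \<delta>" "0 < \<delta>" "0 < m"
  shows "enat ((2 ^ card W - 1) ^ N)
         \<le> sep_number (hyperspace X) (hausdorff_dist dist) (\<lambda>_. hyper_map f) (m * N) \<epsilon>"
proof -
  define P where "P = Pow W - {{}}"
  define g where "g = f ^^ m"
  have "\<exists>x. \<forall>i<N. (g ^^ i) x \<in> J (t i)" if "\<And>i. i < N \<Longrightarrow> t i \<in> W" for t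
  proof -
    obtain w y where "w \<in> W" "y \<in> J w" using W J by blast
    with itinerary_exists[where J=J and g=g and W=W and N=N] cov that
    show ?thesis unfolding g_def by metis
  qed
  then have "\<exists>x. \<forall>t. (\<forall>i<N. t i \<in> W) \<longrightarrow> (\<forall>i<N. (g ^^ i) (x t) \<in> J (t i))"
    by metis
  then obtain x where x: "\<And>t i. (\<And>i. i < N \<Longrightarrow> t i \<in> W) \<Longrightarrow> i < N \<Longrightarrow> (g ^^ i) (x t) \<in> J (t i)"
    by blast
  show ?thesis
  proof (cases "N = 0")
    \<comment> \<open>With no time steps there is no piece to place the points in, so the required
      single set is a singleton taken by hand.\<close>
    case True
    obtain w y where "w \<in> W" "y \<in> J w" using W J by blast
    then have "{y} \<in> hyperspace X" using J(1) by (auto simp: hyperspace_def)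
    then show ?thesis using True
      using card_le_sep_number[of "{{y}}" "hyperspace X" "hausdorff_dist dist" "\<lambda>_. hyper_map f" 0 \<epsilon>]
      by (simp add: nds_separated_def one_enat_def)
  next
    case False
    define A where "A S = x ` (\<Pi>\<^sub>E i\<in>{..<N}. S i)" for S
    have SW: "S i \<subseteq> W" "S i \<noteq> {}" if "S \<in> {..<N} \<rightarrow>\<^sub>E P" "i < N" for S i
      using that by (auto simp: P_def PiE_def Pi_def)
    have xS: "(g ^^ i) (x t) \<in> J (t i)"
      if "S \<in> {..<N} \<rightarrow>\<^sub>E P" "t \<in> (\<Pi>\<^sub>E i\<in>{..<N}. S i)" "i < N" for S t i
    proof (rule x)
      fix i assume "i < N"
      with SW(1)[OF that(1)] PiE_mem[OF that(2)] show "t i \<in> W" by blast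
    qed (use that in auto)
    have AX: "A S \<subseteq> X" if "S \<in> {..<N} \<rightarrow>\<^sub>E P" for S
    proof -
      have "x t \<in> X" if t: "t \<in> (\<Pi>\<^sub>E i\<in>{..<N}. S i)" for t
        using xS[OF \<open>S \<in> {..<N} \<rightarrow>\<^sub>E P\<close> t, of 0] J(1) SW[OF \<open>S \<in> {..<N} \<rightarrow>\<^sub>E P\<close>, of 0]
          PiE_mem[OF t, of 0] False by auto
      then show ?thesis by (auto simp: A_def)
    qed
    have ne: "A S \<noteq> {}" if "S \<in> {..<N} \<rightarrow>\<^sub>E P" for S
      using SW[OF that] by (simp add: A_def PiE_eq_empty_iff)
    have finW: "finite (S i)" if "S \<in> {..<N} \<rightarrow>\<^sub>E P" "i < N" for S i
      using SW[OF that] W finite_subset by blast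
    have hyp: "A S \<in> hyperspace X" if "S \<in> {..<N} \<rightarrow>\<^sub>E P" for S
    proof -
      have "finite (A S)" unfolding A_def
        using finW[OF that] by (intro finite_imageI finite_PiE) auto
      then show ?thesis using AX[OF that] ne[OF that]
        by (auto simp: hyperspace_def finite_imp_compact)
    qed
    have far: "\<exists>a\<in>(g ^^ i) ` A S. \<forall>b\<in>(g ^^ i) ` A T. \<delta> \<le> dist a b"
      if S: "S \<in> {..<N} \<rightarrow>\<^sub>E P" and T: "T \<in> {..<N} \<rightarrow>\<^sub>E P" and i: "i < N" and w: "w \<in> S i" "w \<notin> T i"
      for S T i w
    proof -
      obtain s where s: "s \<in> (\<Pi>\<^sub>E i\<in>{..<N}. S i)" using ne[OF S] by (auto simp: A_def)
      \<comment> \<open>Redirecting one itinerary at step \<open>i\<close> to \<open>w\<close> gives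
        a point of \<open>A S\<close> that is then in \<open>J w\<close>, while all points of
        \<open>A T\<close> are in other pieces.\<close>
      define s' where "s' = s(i := w)"
      have s': "s' \<in> (\<Pi>\<^sub>E i\<in>{..<N}. S i)"
        using s w i by (auto simp: s'_def PiE_def Pi_def extensional_def)
      have a: "(g ^^ i) (x s') \<in> J w" using xS[OF S s' i] by (simp add: s'_def)
      have "\<delta> \<le> dist ((g ^^ i) (x s')) ((g ^^ i) (x t))" if t: "t \<in> (\<Pi>\<^sub>E i\<in>{..<N}. T i)" for t
      proof (rule sep[of w "t i"])
        show "w \<in> W" "t i \<in> W" "w \<noteq> t i"
          using w SW(1)[OF S i] SW(1)[OF T i] PiE_mem[OF t, of i] i by auto
      qed (use a xS[OF T t i] in auto)
      then show ?thesis using s' by (auto simp: A_def)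
    qed
    define D where "D = diameter X"
    have D: "dist a b \<le> D" if "a \<in> X" "b \<in> X" for a b
      using that X(2) by (auto simp: D_def diameter_bounded_bound)
    have gX: "(g ^^ i) a \<in> X" if "a \<in> X" for a i
      using that nds_iter_in[of X "\<lambda>_. f" a "m * i"] X(1)
      by (auto simp: g_def funpow_mult nds_iter_const mult.commute)
    have hd: "\<epsilon> < hausdorff_dist dist ((g ^^ i) ` A S) ((g ^^ i) ` A T)"
      if S: "S \<in> {..<N} \<rightarrow>\<^sub>E P" and T: "T \<in> {..<N} \<rightarrow>\<^sub>E P" and i: "i < N" and ne_i: "S i \<noteq> T i" for S T i
    proof -
      have *: "\<delta> \<le> hausdorff_dist dist ((g ^^ i) ` A S) ((g ^^ i) ` A T)"
        if ST: "S \<in> {..<N} \<rightarrow>\<^sub>E P" "T \<in> {..<N} \<rightarrow>\<^sub>E P" "w \<in> S i" "w \<notin> T i" for S T w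
      proof -
        obtain a where a: "a \<in> (g ^^ i) ` A S" "\<forall>b\<in>(g ^^ i) ` A T. \<delta> \<le> dist a b"
          using far[OF ST(1,2) i ST(3,4)] by blast
        show ?thesis
        proof (rule hausdorff_dist_ge[OF a(1), where D = D])
          fix a b assume "a \<in> (g ^^ i) ` A S" "b \<in> (g ^^ i) ` A T"
          then show "0 \<le> dist a b \<and> dist a b \<le> D"
            using AX[OF ST(1)] AX[OF ST(2)] gX by (auto intro!: D)
        qed (use a ne[OF ST(2)] in auto)
      qed
      from ne_i obtain w where "w \<in> S i \<and> w \<notin> T i \<or> w \<in> T i \<and> w \<notin> S i" by blast
      then have "\<delta> \<le> hausdorff_dist dist ((g ^^ i) ` A S) ((g ^^ i) ` A T)"
        using *[OF S T] *[OF T S]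
          hausdorff_dist_flip[of dist "(g ^^ i) ` A S" "(g ^^ i) ` A T"]
        by (auto simp: dist_commute)
      then show ?thesis using \<open>\<epsilon> < \<delta>\<close> by simp
    qed
    have neq: "\<exists>i<N. S i \<noteq> T i" if "S \<in> {..<N} \<rightarrow>\<^sub>E P" "T \<in> {..<N} \<rightarrow>\<^sub>E P" "S \<noteq> T" for S T
      using that PiE_ext by (metis lessThan_iff)
    \<comment> \<open>If \<open>A S = A T\<close> for distinct \<open>S\<close>, \<open>T\<close>,
      some point would have distance at least \<delta> > 0 from every point of a set containing
      it.\<close>
    have "inj_on A ({..<N} \<rightarrow>\<^sub>E P)"
    proof (rule inj_onI, rule ccontr)
      fix S T assume ST: "S \<in> {..<N} \<rightarrow>\<^sub>E P" "T \<in> {..<N} \<rightarrow>\<^sub>E P" "A S = A T" "S \<noteq> T"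
      then obtain i w where i: "i < N" "w \<in> S i \<and> w \<notin> T i \<or> w \<in> T i \<and> w \<notin> S i"
        using neq by blast
      then obtain a where "a \<in> (g ^^ i) ` A S" "\<forall>b\<in>(g ^^ i) ` A S. \<delta> \<le> dist a b"
        using far[OF ST(1,2)] far[OF ST(2,1)] ST(3) by metis
      then show False using \<open>0 < \<delta>\<close> by force
    qed
    then have "card (A ` ({..<N} \<rightarrow>\<^sub>E P)) = card P ^ N"
      by (simp add: card_image card_PiE)
    also have "card P = 2 ^ card W - 1"
      using W by (simp add: P_def card_Pow)
    finally have card: "card (A ` ({..<N} \<rightarrow>\<^sub>E P)) = (2 ^ card W - 1) ^ N" .
    have "enat (card (A ` ({..<N} \<rightarrow>\<^sub>E P)))
        \<le> sep_number (hyperspace X) (hausdorff_dist dist) (\<lambda>_. hyper_map f) (m * N) \<epsilon>"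
    proof (rule card_le_sep_number)
      show "A ` ({..<N} \<rightarrow>\<^sub>E P) \<subseteq> hyperspace X" using hyp by blast
      show "finite (A ` ({..<N} \<rightarrow>\<^sub>E P))"
        using W by (intro finite_imageI finite_PiE) (auto simp: P_def)
      show "nds_separated (hausdorff_dist dist) (\<lambda>_. hyper_map f) (m * N) \<epsilon> (A ` ({..<N} \<rightarrow>\<^sub>E P))"
        unfolding nds_separated_def
      proof (intro ballI impI)
        fix B C assume BC: "B \<in> A ` ({..<N} \<rightarrow>\<^sub>E P)" "C \<in> A ` ({..<N} \<rightarrow>\<^sub>E P)" "B \<noteq> C"
        then obtain S T where ST: "S \<in> {..<N} \<rightarrow>\<^sub>E P" "T \<in> {..<N} \<rightarrow>\<^sub>E P" "B = A S" "C = A T"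
          by blast
        with BC(3) obtain i where i: "i < N" "S i \<noteq> T i" using neq by metis
        have "nds_iter (\<lambda>_. f) (m * i) = g ^^ i"
          by (simp add: nds_iter_const g_def funpow_mult)
        then have "\<epsilon> < hausdorff_dist dist (nds_iter (\<lambda>_. hyper_map f) (m * i) (A S))
                   (nds_iter (\<lambda>_. hyper_map f) (m * i) (A T))"
          using hd[OF ST(1,2) i] nds_iter_hyper_map[of "\<lambda>_. f"] by simp
        moreover have "m * i < m * N" using i \<open>0 < m\<close> by simp
        ultimately show "\<exists>k<m * N. \<epsilon> < hausdorff_dist dist (nds_iter (\<lambda>_. hyper_map f) k B)
                   (nds_iter (\<lambda>_. hyper_map f) k C)" using ST(3,4) by blast
      qed
    qed
    with card show ?thesis by simp
  qed
qed

text \<open>Along multiples of \<open>m\<close> the preceding count yields exactly this constant,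
  and a subsequence bounds the limsup from below.\<close>

lemma hyper_rate_horseshoe:
  fixes J :: "'w \<Rightarrow> 'a::metric_space set"
  assumes X: "f \<in> X \<rightarrow> X" "bounded X"
    and W: "finite W" "W \<noteq> {}" and J: "\<And>w. w \<in> W \<Longrightarrow> J w \<subseteq> X" "\<And>w. w \<in> W \<Longrightarrow> J w \<noteq> {}"
    and cov: "\<And>v w. v \<in> W \<Longrightarrow> w \<in> W \<Longrightarrow> J w \<subseteq> (f ^^ m) ` J v"
    and sep: "\<And>v w x y. v \<in> W \<Longrightarrow> w \<in> W \<Longrightarrow> v \<noteq> w \<Longrightarrow> x \<in> J v \<Longrightarrow> y \<in> J w \<Longrightarrow> \<delta> \<le> dist x y"
    and "\<epsilon> < \<delta>" "0 < \<delta>" "0 < m"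
  shows "ereal (ln (2 ^ card W - 1) / m)
         \<le> entropy_rate (hyperspace X) (hausdorff_dist dist) (\<lambda>_. hyper_map f) \<epsilon>"
proof -
  let ?h = "\<lambda>n. ereal (1 / real n) *
    ln_enat (sep_number (hyperspace X) (hausdorff_dist dist) (\<lambda>_. hyper_map f) n \<epsilon>)"
  \<comment> \<open>\<open>Suc N\<close> keeps the time positive, so that dividing by it is
    legitimate.\<close>
  have "ereal (ln (2 ^ card W - 1) / m) \<le> ?h (m * Suc N)" for N
  proof -
    have c: "card W \<ge> 1" using W by (simp add: Suc_leI card_gt_0_iff)
    have "(2::nat) ^ 1 \<le> 2 ^ card W" using c by (intro power_increasing) auto
    then have real: "real ((2 ^ card W - 1) ^ Suc N) = (2 ^ card W - 1) ^ Suc N" "(2::real) ^ card W - 1 \<ge> 1"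
      using power_increasing[OF c, of "2::real"] by (auto simp: of_nat_diff)
    have "ereal (real (Suc N) * ln (2 ^ card W - 1)) = ln_enat (enat ((2 ^ card W - 1) ^ Suc N))"
      unfolding ln_enat_def using real by (simp add: ln_realpow del: power_Suc)
    also have "\<dots> \<le> ln_enat (sep_number (hyperspace X) (hausdorff_dist dist) (\<lambda>_. hyper_map f) (m * Suc N) \<epsilon>)"
      by (intro ln_enat_mono hyper_sep_number_horseshoe[where J = J and \<delta> = \<delta>] assms)
    finally have "ereal (1 / real (m * Suc N)) * ereal (real (Suc N) * ln (2 ^ card W - 1)) \<le> ?h (m * Suc N)"
      by (intro ereal_mult_left_mono) auto
    moreover have "1 / real (m * Suc N) * (real (Suc N) * ln (2 ^ card W - 1)) = ln (2 ^ card W - 1) / m"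
      unfolding of_nat_mult using \<open>0 < m\<close> by (simp del: of_nat_Suc)
    ultimately show ?thesis by (metis times_ereal.simps(1))
  qed
  then have "ereal (ln (2 ^ card W - 1) / m) \<le> limsup (?h \<circ> (\<lambda>N. m * Suc N))"
    by (intro le_Limsup always_eventually) auto
  also have "\<dots> \<le> limsup ?h"
    using \<open>0 < m\<close> by (intro limsup_subseq_mono) (auto simp: strict_mono_def)
  finally show ?thesis unfolding entropy_rate_def .
qed

section \<open>Unbounded rates from a two-piece horseshoe\<close>

definition horseshoe :: "('a::metric_space \<Rightarrow> 'a) \<Rightarrow> 'a set \<Rightarrow> 'a set \<Rightarrow> bool" where
  "horseshoe g A B \<longleftrightarrow> compact A \<and> compact B \<and> A \<noteq> {} \<and> B \<noteq> {} \<and> A \<inter> B = {} \<and>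
     A \<union> B \<subseteq> g ` A \<and> A \<union> B \<subseteq> g ` B"

lemma funpow_continuous_in:
  assumes "continuous_on X g" "g \<in> X \<rightarrow> X"
  shows "continuous_on X (g ^^ n) \<and> g ^^ n \<in> X \<rightarrow> X"
proof (induction n)
  case (Suc n)
  then have "continuous_on ((g ^^ n) ` X) g"
    using assms by (auto intro: continuous_on_subset)
  then have "continuous_on X (g \<circ> g ^^ n)"
    using Suc by (blast intro: continuous_on_compose)
  then show ?case using Suc assms by (auto simp: o_def)
qed auto

text \<open>Passing to the \<open>k\<close>-th iterate divides the rate by \<open>k\<close> only,
  while the number of nonempty families of pieces becomes doubly exponential in
  \<open>k\<close>.\<close>

lemma hyper_rate_unbounded_horseshoe:
  fixes f :: "'a::heine_borel \<Rightarrow> 'a"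
  assumes X: "compact X" "continuous_on X f" "f \<in> X \<rightarrow> X"
    and H: "horseshoe (f ^^ m) A B" "A \<subseteq> X" "B \<subseteq> X" "0 < m"
  shows "\<exists>\<epsilon>>0. ereal r < entropy_rate (hyperspace X) (hausdorff_dist dist) (\<lambda>_. hyper_map f) \<epsilon>"
proof -
  define g where "g = f ^^ m"
  \<comment> \<open>The numerator is a lower bound for the logarithm of
    \<open>2 ^ 2 ^ k - 1\<close>, to be divided by the time \<open>m * k\<close>.\<close>
  have "filterlim (\<lambda>k. (2 ^ k - 1) * ln 2 / real k) at_top at_top"
    by real_asymp
  then have "eventually (\<lambda>k. (2 ^ k - 1) * ln 2 / real k > real m * \<bar>r\<bar>) at_top"
    by (simp add: filterlim_at_top_dense)
  then have "eventually (\<lambda>k. (2 ^ k - 1) * ln 2 / real k > real m * \<bar>r\<bar> \<and> k > 0) at_top"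
    using eventually_gt_at_top[of 0] by eventually_elim auto
  then obtain k where k: "(2 ^ k - 1) * ln 2 / real k > real m * \<bar>r\<bar>" "k > 0"
    by (auto simp: eventually_at_top_linorder)
  \<comment> \<open>Words of length \<open>k\<close> in two letters, extensional so that distinct
    words differ at an index below \<open>k\<close>.\<close>
  define W where "W = {..<k} \<rightarrow>\<^sub>E (UNIV :: bool set)"
  define I where "I b = (if b then A else B)" for b
  define J where "J w = {x \<in> X. \<forall>i<k. (g ^^ i) x \<in> I (w i)}" for w
  have W: "finite W" "card W = 2 ^ k" "W \<noteq> {}"
    by (auto simp: W_def finite_PiE card_PiE PiE_eq_empty_iff)
  have gc: "continuous_on X (g ^^ i)" "g ^^ i \<in> X \<rightarrow> X" for i
    using funpow_continuous_in[OF X(2,3)] by (auto simp: g_def funpow_mult)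
  have Icov: "I c \<subseteq> g ` I b" for b c
    using H(1) by (auto simp: I_def horseshoe_def g_def)
  have Isub: "I b \<subseteq> X" for b using H by (auto simp: I_def)
  have cov: "I c \<subseteq> (g ^^ k) ` J w" for w c
  proof
    fix y assume "y \<in> I c"
    then obtain x where x: "\<forall>i<k. (g ^^ i) x \<in> I (w i)" "(g ^^ k) x = y"
      using itinerary_exists[of UNIV I g y c k w] Icov by auto
    then have "x \<in> J w" using k(2) Isub by (force simp: J_def)
    with x show "y \<in> (g ^^ k) ` J w" by blast
  qed
  have JI: "J w \<subseteq> I (w 0)" for w using k(2) by (auto simp: J_def)
  have Jne: "J w \<noteq> {}" for w
    using cov[of True w] H(1) by (auto simp: I_def horseshoe_def)
  \<comment> \<open>Compactness turns disjointness of the pieces into a positive gap between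
    them.\<close>
  have Jc: "compact (J w)" for w
  proof -
    have "J w = (\<Inter>i\<in>{..<k}. X \<inter> (g ^^ i) -` I (w i))"
      using k(2) by (auto simp: J_def)
    moreover have "closedin (top_of_set X) (X \<inter> (g ^^ i) -` I (w i))" for i
      using gc H(1) by (intro continuous_closedin_preimage)
        (auto simp: I_def horseshoe_def compact_imp_closed)
    then have "closedin (top_of_set X) (\<Inter>i\<in>{..<k}. X \<inter> (g ^^ i) -` I (w i))"
      using k(2) by (intro closedin_INT) auto
    ultimately have "closedin (top_of_set X) (J w)" by simp
    then show ?thesis using X(1) closedin_compact by blast
  qed
  have Jd: "J v \<inter> J w = {}" if vw: "v \<in> W" "w \<in> W" "v \<noteq> w" for v w
  proof -
    obtain i where i: "i < k" "v i \<noteq> w i"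
      using PiE_ext[OF vw(1,2)[unfolded W_def]] vw(3) by blast
    have "I True \<inter> I False = {}" using H(1) by (auto simp: I_def horseshoe_def)
    then have "I (v i) \<inter> I (w i) = {}" using i by (cases "v i"; cases "w i") auto
    then show ?thesis using i(1) by (auto simp: J_def)
  qed
  \<comment> \<open>As there are finitely many pairs of pieces, one gap \<delta> works for all of
    them.\<close>
  have "\<forall>\<^sub>F \<delta> in at_right 0. \<forall>v\<in>W. \<forall>w\<in>W. v \<noteq> w \<longrightarrow> (\<forall>x\<in>J v. \<forall>y\<in>J w. \<delta> \<le> dist x y)"
  proof (intro eventually_ball_finite ballI W)
    fix v w assume vw: "v \<in> W" "w \<in> W"
    show "\<forall>\<^sub>F \<delta> in at_right 0. v \<noteq> w \<longrightarrow> (\<forall>x\<in>J v. \<forall>y\<in>J w. \<delta> \<le> dist x y)"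
    proof (cases "v = w")
      case False
      obtain d where "d > 0" "\<forall>x\<in>J v. \<forall>y\<in>J w. d \<le> dist x y"
        using separate_compact_closed[OF Jc compact_imp_closed[OF Jc] Jd[OF vw False]] by blast
      then show ?thesis
        unfolding eventually_at_right_field by (meson less_imp_le order_trans)
    qed simp
  qed
  then obtain \<delta> where \<delta>: "\<delta> > 0" "\<And>v w x y. v \<in> W \<Longrightarrow> w \<in> W \<Longrightarrow> v \<noteq> w \<Longrightarrow> x \<in> J v \<Longrightarrow> y \<in> J w \<Longrightarrow> \<delta> \<le> dist x y"
    unfolding eventually_at_right_field by (metis dense)
  have "ereal (ln (2 ^ card W - 1) / real (m * k))
      \<le> entropy_rate (hyperspace X) (hausdorff_dist dist) (\<lambda>_. hyper_map f) (\<delta> / 2)"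
  proof (rule hyper_rate_horseshoe[where J = J and \<delta> = \<delta>])
    fix v w assume "v \<in> W" "w \<in> W"
    show "J w \<subseteq> (f ^^ (m * k)) ` J v"
      using cov[of "w 0" v] JI[of w] by (auto simp: g_def funpow_mult)
    show "J w \<subseteq> X" by (auto simp: J_def)
  next
    show "bounded X" using X(1) by (rule compact_imp_bounded)
  qed (use X(3) W \<delta> H(4) k(2) Jne in auto)
  moreover have "r < ln (2 ^ card W - 1) / real (m * k)"
  proof -
    have "(2::nat) ^ 0 \<le> 2 ^ k" by (intro power_increasing) auto
    \<comment> \<open>Writing \<open>2 ^ k\<close> as \<open>Suc p\<close> gives
      \<open>2 ^ 2 ^ k - 1 \<ge> 2 ^ p\<close>, whose logarithm is linear in
      \<open>p\<close>.\<close>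
    then obtain p where p: "2 ^ k = Suc p" by (metis Suc_pred' power_0 zero_less_numeral zero_less_power)
    have "(2::real) ^ p * 1 \<le> 2 ^ p * 2 - 1" by simp
    then have "ln (2 ^ p) \<le> ln (2 ^ card W - 1 :: real)"
      unfolding W p by (intro ln_mono) (auto simp: mult.commute)
    moreover have "ln (2 ^ p :: real) = (2 ^ k - 1) * ln 2"
      using p by (simp add: ln_realpow) (metis add_diff_cancel_left' of_nat_Suc of_nat_numeral of_nat_power)
    ultimately have "real m * \<bar>r\<bar> * real k < ln (2 ^ card W - 1)"
      using k by (simp add: field_simps)
    moreover have "r * real (m * k) \<le> real m * \<bar>r\<bar> * real k"
      by (simp add: mult.assoc mult.left_commute mult_left_mono mult_right_mono)
    ultimately have "r * real (m * k) < ln (2 ^ card W - 1)" by linarith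
    moreover have "0 < real (m * k)" using H(4) k(2) by simp
    ultimately show ?thesis by (subst pos_less_divide_eq)
  qed
  ultimately show ?thesis using \<delta>(1)
    by (intro exI[of _ "\<delta> / 2"]) (auto intro: less_le_trans[rotated])
qed

section \<open>Transitive maps of an interval\<close>

text \<open>The endpoints are left general because the results are also applied to the square of the
  map on one side of a fixed point.\<close>

locale transitive_interval_map =
  fixes g :: "real \<Rightarrow> real" and a b :: real
  assumes ab: "a < b" and self_map: "self_map_on {a..b} g"
    and transitive: "nds_transitive {a..b} (\<lambda>_. g)"
begin

lemma continuous: "continuous_on {a..b} (g ^^ n)"
  and in_interval: "x \<in> {a..b} \<Longrightarrow> (g ^^ n) x \<in> {a..b}"
  using funpow_continuous_in[of "{a..b}" g n] self_map by (auto simp: self_map_on_def Pi_iff)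

lemma continuous1: "continuous_on {a..b} g"
  and in_interval1: "x \<in> {a..b} \<Longrightarrow> g x \<in> {a..b}"
  using self_map by (auto simp: self_map_on_def Pi_iff)

lemma hits:
  assumes "openin (top_of_set {a..b}) U" "U \<noteq> {}" "openin (top_of_set {a..b}) V" "V \<noteq> {}"
  obtains n x where "n \<ge> 1" "x \<in> U" "(g ^^ n) x \<in> V"
  using assms transitive unfolding nds_transitive_def nds_iter_const by blast

lemma openin_Ioo: "a \<le> u \<Longrightarrow> v \<le> b \<Longrightarrow> openin (top_of_set {a..b}) {u<..<v}"
  by (rule open_subset) auto

text \<open>The points missed by the compact image form a relatively open set. No orbit enters it at
  a time \<open>n \<ge> 1\<close>, so transitivity makes it empty.\<close>

lemma surjective: "g ` {a..b} = {a..b}"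
proof (rule ccontr)
  assume "g ` {a..b} \<noteq> {a..b}"
  then have ne: "{a..b} - g ` {a..b} \<noteq> {}" using in_interval1 by blast
  have "closed (g ` {a..b})"
    by (intro compact_imp_closed compact_continuous_image continuous1) auto
  then have "openin (top_of_set {a..b}) ({a..b} - g ` {a..b})"
    by (simp add: Diff_eq openin_open_Int open_Compl)
  with ne ab obtain n x where n: "n \<ge> 1" "x \<in> {a..b}" "(g ^^ n) x \<in> {a..b} - g ` {a..b}"
    using hits[of "{a..b}" "{a..b} - g ` {a..b}"] by auto
  then obtain k where "n = Suc k" by (cases n) auto
  with n in_interval[of x k] show False by auto
qed

text \<open>To hit the target after time \<open>r\<close>, hit its preimage under
  \<open>g ^^ r\<close>, which is relatively open and, by surjectivity, nonempty.\<close>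

lemma hits_late:
  assumes "a \<le> u" "u < v" "v \<le> b" "a \<le> s" "s < t" "t \<le> b"
  obtains n x where "n > r" "x \<in> {u<..<v}" "(g ^^ n) x \<in> {s<..<t}"
proof -
  let ?V = "{a..b} \<inter> (g ^^ r) -` {s<..<t}"
  have "(g ^^ r) ` {a..b} = {a..b}"
  proof (induction r)
    case (Suc r)
    have "(g ^^ Suc r) ` {a..b} = g ` (g ^^ r) ` {a..b}" by (simp add: image_comp)
    then show ?case using Suc surjective by simp
  qed auto
  moreover have st: "(s + t) / 2 \<in> {s<..<t}" "(s + t) / 2 \<in> {a..b}" using assms by auto
  ultimately obtain w where "w \<in> {a..b}" "(g ^^ r) w = (s + t) / 2" by (metis imageE)
  then have "w \<in> ?V" using st by simp
  then have "?V \<noteq> {}" by blast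
  moreover have "openin (top_of_set {a..b}) ?V"
    using continuous in_interval assms
    by (intro continuous_openin_preimage[OF _ _ openin_Ioo]) (auto simp: Pi_iff)
  moreover have "(u + v) / 2 \<in> {u<..<v}" using assms by auto
  ultimately obtain n x where "n \<ge> 1" "x \<in> {u<..<v}" "(g ^^ n) x \<in> ?V"
    using hits[OF openin_Ioo[OF assms(1,3)], of ?V] by blast
  then have "r + n > r" "(g ^^ (r + n)) x \<in> {s<..<t}" by (auto simp: funpow_add)
  with that \<open>x \<in> {u<..<v}\<close> show ?thesis by blast
qed

text \<open>Orbits starting in an invariant subinterval never reach a gap left at either
  end.\<close>

lemma no_invariant_subinterval:
  assumes "a \<le> c" "c < d" "d \<le> b" "g ` {c..d} \<subseteq> {c..d}"
  shows "c = a \<and> d = b"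
proof -
  have inv: "(g ^^ n) x \<in> {c..d}" if "x \<in> {c..d}" for n x
    using that assms(4) by (induction n) (auto simp: image_subset_iff)
  have "\<not> a < c"
  proof
    assume "a < c"
    then obtain n x where "n > 0" "x \<in> {c<..<d}" "(g ^^ n) x \<in> {a<..<c}"
      using hits_late[of c d a c 0] assms by auto
    then show False using inv[of x n] by auto
  qed
  moreover have "\<not> d < b"
  proof
    assume "d < b"
    then obtain n x where "n > 0" "x \<in> {c<..<d}" "(g ^^ n) x \<in> {d<..<b}"
      using hits_late[of c d d b 0] assms by auto
    then show False using inv[of x n] by auto
  qed
  ultimately show ?thesis using assms by auto
qed

text \<open>From time \<open>r\<close> on, the image of the interval is connected and contains
  \<open>p\<close>; at some later time it also contains a point beyond \<beta>. As \<beta> is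
  interior, the gap beyond it is an open target for \<open>hits_late\<close>.\<close>

lemma image_covers_segment:
  assumes p: "p \<in> {a..b}" "g p = p" and "u < v" "{u..v} \<subseteq> {a..b}"
    and z: "z \<in> {u..v}" "(g ^^ r) z = p" and \<beta>: "\<beta> \<in> {a<..<b}"
  obtains n where "n > 0" "closed_segment p \<beta> \<subseteq> (g ^^ n) ` {u..v}"
proof -
  have fixp: "(g ^^ n) z = p" if "n \<ge> r" for n
  proof -
    have "(g ^^ k) p = p" for k using p(2) by (induction k) auto
    moreover have "g ^^ n = g ^^ (n - r) \<circ> g ^^ r" using that by (simp add: funpow_add[symmetric])
    ultimately show ?thesis using z by simp
  qed
  have uv: "a \<le> u" "v \<le> b" using assms by auto
  obtain n x where n: "n > r" "x \<in> {u<..<v}" "\<beta> \<in> closed_segment p ((g ^^ n) x)"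
  proof (cases "p \<le> \<beta>")
    case True
    obtain n x where "n > r" "x \<in> {u<..<v}" "(g ^^ n) x \<in> {\<beta><..<b}"
      using hits_late[of u v \<beta> b r] uv \<open>u < v\<close> \<beta> by auto
    then show ?thesis using that[of n x] True by (auto simp: closed_segment_eq_real_ivl)
  next
    case False
    obtain n x where "n > r" "x \<in> {u<..<v}" "(g ^^ n) x \<in> {a<..<\<beta>}"
      using hits_late[of u v a \<beta> r] uv \<open>u < v\<close> \<beta> by auto
    then show ?thesis using that[of n x] False by (auto simp: closed_segment_eq_real_ivl)
  qed
  have "connected ((g ^^ n) ` {u..v})"
    using continuous_on_subset[OF continuous assms(4)] by (intro connected_continuous_image) auto
  then have "convex ((g ^^ n) ` {u..v})"
    by (simp add: is_interval_connected_1 is_interval_convex_1[symmetric])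
  moreover have "p \<in> (g ^^ n) ` {u..v}" using fixp[of n] n(1) z(1) by (metis image_eqI less_imp_le)
  moreover have "(g ^^ n) x \<in> (g ^^ n) ` {u..v}" using n(2) by auto
  ultimately have "closed_segment p ((g ^^ n) x) \<subseteq> (g ^^ n) ` {u..v}"
    by (simp add: closed_segment_subset)
  moreover have "closed_segment p \<beta> \<subseteq> closed_segment p ((g ^^ n) x)"
    using n(3) by (intro closed_segment_subset) auto
  ultimately show ?thesis using that[of n] n(1) by auto
qed

text \<open>
  A homoclinic point of a fixed point gives a horseshoe: two disjoint intervals, one containing
  \<open>p\<close> and one containing \<open>z\<close>, cover each other after \<open>n\<^sub>0\<close> resp.\ \<open>n\<^sub>1\<close> steps,
  hence both after \<open>n\<^sub>0 + n\<^sub>1\<close> steps.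
\<close>

lemma horseshoe_homoclinic:
  assumes p: "p \<in> {a..b}" "g p = p" and z: "z \<in> {a<..<b}" "z \<noteq> p" "(g ^^ r) z = p"
  shows "\<exists>m>0. \<exists>A B. horseshoe (g ^^ m) A B \<and> A \<subseteq> {a..b} \<and> B \<subseteq> {a..b}"
proof -
  obtain u v u' v' \<beta> where *: "u < v" "u' < v'" "p \<in> {u..v}" "z \<in> {u'..v'}" "{u..v} \<inter> {u'..v'} = {}"
    "{u..v} \<subseteq> {a..b}" "{u'..v'} \<subseteq> {a..b}" "\<beta> \<in> {a<..<b}" "{u..v} \<union> {u'..v'} \<subseteq> closed_segment p \<beta>"
  proof (cases "p < z")
    case True
    show ?thesis
    proof (rule that)
      \<comment> \<open>Two intervals separated by the middle third between \<open>p\<close> and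
        \<open>z\<close>. The outer endpoint of the second serves as \<beta>; it stays interior
        because \<open>z\<close> is.\<close>
      let ?u = p and ?v = "p + (z - p) / 3" and ?u' = "p + 2 * (z - p) / 3" and ?v' = "(z + b) / 2"
      show "?u < ?v" "?u' < ?v'" "p \<in> {?u..?v}" "z \<in> {?u'..?v'}" "{?u..?v} \<inter> {?u'..?v'} = {}"
        "{?u..?v} \<subseteq> {a..b}" "{?u'..?v'} \<subseteq> {a..b}" "?v' \<in> {a<..<b}"
        "{?u..?v} \<union> {?u'..?v'} \<subseteq> closed_segment p ?v'"
        using True p(1) z(1) by (auto simp: closed_segment_eq_real_ivl field_simps)
    qed
  next
    case False
    show ?thesis
    proof (rule that)
      let ?v = p and ?u = "p - (p - z) / 3" and ?v' = "p - 2 * (p - z) / 3" and ?u' = "(z + a) / 2"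
      show "?u < ?v" "?u' < ?v'" "p \<in> {?u..?v}" "z \<in> {?u'..?v'}" "{?u..?v} \<inter> {?u'..?v'} = {}"
        "{?u..?v} \<subseteq> {a..b}" "{?u'..?v'} \<subseteq> {a..b}" "?u' \<in> {a<..<b}"
        "{?u..?v} \<union> {?u'..?v'} \<subseteq> closed_segment p ?u'"
        using False p(1) z(1,2) by (auto simp: closed_segment_eq_real_ivl field_simps)
    qed
  qed
  let ?A = "{u..v}" and ?B = "{u'..v'}"
  obtain n\<^sub>0 where n0: "n\<^sub>0 > 0" "closed_segment p \<beta> \<subseteq> (g ^^ n\<^sub>0) ` ?A"
    using image_covers_segment[OF p *(1) *(6) *(3), of 0] *(8) by auto
  obtain n\<^sub>1 where n1: "n\<^sub>1 > 0" "closed_segment p \<beta> \<subseteq> (g ^^ n\<^sub>1) ` ?B"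
    using image_covers_segment[OF p *(2) *(7) *(4) z(3) *(8)] by auto
  have cov: "?A \<union> ?B \<subseteq> (g ^^ (i + j)) ` S"
    if "closed_segment p \<beta> \<subseteq> (g ^^ i) ` T" "closed_segment p \<beta> \<subseteq> (g ^^ j) ` S" "T \<subseteq> ?A \<union> ?B" for i j S T
  proof -
    have "T \<subseteq> (g ^^ j) ` S" using that(2,3) *(9) by blast
    then have "(g ^^ i) ` T \<subseteq> (g ^^ (i + j)) ` S" by (auto simp: funpow_add)
    then show ?thesis using that(1) *(9) by blast
  qed
  have "?A \<union> ?B \<subseteq> (g ^^ (n\<^sub>0 + n\<^sub>1)) ` ?B" "?A \<union> ?B \<subseteq> (g ^^ (n\<^sub>1 + n\<^sub>0)) ` ?A"
    using cov n0 n1 by blast+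
  then have "horseshoe (g ^^ (n\<^sub>0 + n\<^sub>1)) ?A ?B"
    using * by (auto simp: horseshoe_def add.commute)
  moreover have "n\<^sub>0 + n\<^sub>1 > 0" using n0(1) by simp
  ultimately show ?thesis using *(6,7) by blast
qed

section \<open>Fixed points and the exchange of their sides\<close>

lemma one_sided:
  fixes h :: "real \<Rightarrow> real"
  assumes "continuous_on {c..d} h" "\<And>x. x \<in> {c<..<d} \<Longrightarrow> h x \<noteq> p"
  shows "(\<forall>x\<in>{c..d}. h x \<le> p) \<or> (\<forall>x\<in>{c..d}. p \<le> h x)"
proof (rule ccontr)
  assume "\<not> ?thesis"
  then obtain x y where xy: "x \<in> {c..d}" "p < h x" "y \<in> {c..d}" "h y < p"
    by (auto simp: not_le)
  have "\<exists>z. min x y \<le> z \<and> z \<le> max x y \<and> h z = p"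
  proof (cases "x \<le> y")
    case True
    then show ?thesis using IVT2'[of h y p x] xy continuous_on_subset[OF assms(1), of "{x..y}"] by auto
  next
    case False
    then show ?thesis using IVT'[of h y p x] xy continuous_on_subset[OF assms(1), of "{y..x}"] by auto
  qed
  then obtain z where z: "min x y \<le> z" "z \<le> max x y" "h z = p" by blast
  then have "z \<noteq> x" "z \<noteq> y" using xy by auto
  with z xy have "z \<in> {c<..<d}" by (auto simp: min_def max_def split: if_splits)
  with assms(2) z(3) show False by blast
qed

text \<open>Otherwise \<open>g x - x\<close> has constant sign, and one of the two halves of the
  interval is invariant.\<close>

lemma interior_fixed_point:
  "\<exists>p\<in>{a<..<b}. g p = p"
proof (rule ccontr)
  assume "\<not> ?thesis"
  then have "g x - x \<noteq> 0" if "x \<in> {a<..<b}" for x using that by auto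
  then have "(\<forall>x\<in>{a..b}. g x - x \<le> 0) \<or> (\<forall>x\<in>{a..b}. 0 \<le> g x - x)"
    by (intro one_sided continuous_intros continuous1)
  then have "g ` {a..(a + b) / 2} \<subseteq> {a..(a + b) / 2} \<or> g ` {(a + b) / 2..b} \<subseteq> {(a + b) / 2..b}"
  proof (elim disjE)
    assume "\<forall>x\<in>{a..b}. g x - x \<le> 0"
    then have "g x \<in> {a..(a + b) / 2}" if "x \<in> {a..(a + b) / 2}" for x
      using that in_interval1[of x] ab by (auto dest!: bspec[of _ _ x])
    then show ?thesis by blast
  next
    assume "\<forall>x\<in>{a..b}. 0 \<le> g x - x"
    then have "g x \<in> {(a + b) / 2..b}" if "x \<in> {(a + b) / 2..b}" for x
      using that in_interval1[of x] ab by (auto dest!: bspec[of _ _ x])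
    then show ?thesis by blast
  qed
  then show False
    using no_invariant_subinterval[of a "(a + b) / 2"] no_invariant_subinterval[of "(a + b) / 2" b] ab
    by auto
qed

text \<open>Each side of \<open>p\<close> is mapped into a single side by \<open>one_sided\<close>,
  and not into itself, since it would be a proper invariant subinterval.\<close>

lemma switch:
  assumes p: "p \<in> {a<..<b}" "g p = p" and no: "\<And>z. z \<in> {a<..<b} \<Longrightarrow> z \<noteq> p \<Longrightarrow> g z \<noteq> p"
  shows "g ` {a..p} \<subseteq> {p..b}" "g ` {p..b} \<subseteq> {a..p}"
proof -
  have "\<not> (\<forall>x\<in>{a..p}. g x \<le> p)"
  proof
    assume "\<forall>x\<in>{a..p}. g x \<le> p"
    then have "g ` {a..p} \<subseteq> {a..p}" using in_interval1 p by force
    then show False using no_invariant_subinterval[of a p] p by auto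
  qed
  moreover have "(\<forall>x\<in>{a..p}. g x \<le> p) \<or> (\<forall>x\<in>{a..p}. p \<le> g x)"
  proof (rule one_sided)
    show "continuous_on {a..p} g" by (rule continuous_on_subset[OF continuous1]) (use p in auto)
  qed (use no p in auto)
  ultimately have "\<forall>x\<in>{a..p}. p \<le> g x" by blast
  then show "g ` {a..p} \<subseteq> {p..b}" using in_interval1 p by force
  have "\<not> (\<forall>x\<in>{p..b}. p \<le> g x)"
  proof
    assume "\<forall>x\<in>{p..b}. p \<le> g x"
    then have "g ` {p..b} \<subseteq> {p..b}" using in_interval1 p by force
    then show False using no_invariant_subinterval[of p b] p by auto
  qed
  moreover have "(\<forall>x\<in>{p..b}. g x \<le> p) \<or> (\<forall>x\<in>{p..b}. p \<le> g x)"
  proof (rule one_sided)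
    show "continuous_on {p..b} g" by (rule continuous_on_subset[OF continuous1]) (use p in auto)
  qed (use no p in auto)
  ultimately have "\<forall>x\<in>{p..b}. g x \<le> p" by blast
  then show "g ` {p..b} \<subseteq> {a..p}" using in_interval1 p by force
qed

text \<open>The two sides alternate, so an orbit that starts and ends strictly left of
  \<open>p\<close> takes an even number of steps.\<close>

lemma transitive_square:
  assumes p: "p \<in> {a<..<b}" and sw: "g ` {a..p} \<subseteq> {p..b}" "g ` {p..b} \<subseteq> {a..p}"
  shows "transitive_interval_map (g ^^ 2) a p"
proof
  have even: "(g ^^ (2 * k)) x \<in> {a..p}" if "x \<in> {a..p}" for k x
    using that sw by (induction k) (auto simp: image_subset_iff)
  show "a < p" using p by simp
  show "self_map_on {a..p} (g ^^ 2)"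
    using continuous_on_subset[OF continuous[of 2], of "{a..p}"] even[of _ 1] p
    by (auto simp: self_map_on_def)
  \<comment> \<open>Open intervals inside the given sets avoid the endpoint \<open>p\<close>, the
    only point on both sides.\<close>
  have sub: "\<exists>s t. a \<le> s \<and> s < t \<and> t \<le> p \<and> {s<..<t} \<subseteq> U"
    if U: "openin (top_of_set {a..p}) U" "U \<noteq> {}" for U
  proof -
    obtain T where T: "open T" "U = {a..p} \<inter> T" using U(1) by (auto simp: openin_open)
    obtain x where x: "x \<in> U" using U(2) by blast
    obtain e where e: "e > 0" "ball x e \<subseteq> T" using T x by (meson IntD2 open_contains_ball)
    have "{max a (x - e)<..<min p (x + e)} \<subseteq> U"
      using e(2) T(2) by (auto simp: subset_iff dist_real_def)
    moreover have "max a (x - e) < min p (x + e)" using x T(2) e(1) p by auto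
    ultimately show ?thesis by (meson max.cobounded1 min.cobounded1)
  qed
  show "nds_transitive {a..p} (\<lambda>_. g ^^ 2)"
    unfolding nds_transitive_def
  proof (intro allI impI, elim conjE)
    fix U V assume U: "openin (top_of_set {a..p}) U" "U \<noteq> {}" and V: "openin (top_of_set {a..p}) V" "V \<noteq> {}"
    obtain s t s' t' where st: "a \<le> s" "s < t" "t \<le> p" "{s<..<t} \<subseteq> U" "a \<le> s'" "s' < t'" "t' \<le> p" "{s'<..<t'} \<subseteq> V"
      using sub[OF U] sub[OF V] by blast
    obtain n x where n: "n > 0" "x \<in> {s<..<t}" "(g ^^ n) x \<in> {s'<..<t'}"
      using hits_late[of s t s' t' 0] st p by auto
    have "even n"
    proof (rule ccontr)
      assume "odd n"
      then obtain k where "n = Suc (2 * k)" by (auto elim: oddE)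
      then have "(g ^^ n) x \<in> {p..b}"
        using even[of x k] sw(1) n(2) st by (auto simp: image_subset_iff)
      then show False using n(3) st by auto
    qed
    then obtain k where k: "n = 2 * k" by blast
    then have "nds_iter (\<lambda>_. g ^^ 2) k x \<in> V"
      using n(3) st by (auto simp: nds_iter_const funpow_mult mult.commute)
    moreover have "k \<ge> 1" using n(1) k by simp
    moreover have "x \<in> U" using n(2) st by blast
    ultimately show "\<exists>n\<ge>1. nds_iter (\<lambda>_. g ^^ 2) n ` U \<inter> V \<noteq> {}" by blast
  qed
qed

end

theorem transitive_interval_map_horseshoe:
  assumes "transitive_interval_map g a b"
  shows "\<exists>m>0. \<exists>A B. horseshoe (g ^^ m) A B \<and> A \<subseteq> {a..b} \<and> B \<subseteq> {a..b}"
proof -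
  interpret transitive_interval_map g a b by fact
  obtain p where p: "p \<in> {a<..<b}" "g p = p" using interior_fixed_point by blast
  show ?thesis
  proof (cases "\<exists>z\<in>{a<..<b}. z \<noteq> p \<and> g z = p")
    case True
    then show ?thesis using horseshoe_homoclinic[of p _ 1] p by auto
  next
    case False
    then have sw: "g ` {a..p} \<subseteq> {p..b}" "g ` {p..b} \<subseteq> {a..p}" using switch[OF p] by blast+
    interpret sq: transitive_interval_map "g ^^ 2" a p by (rule transitive_square[OF p(1) sw])
    obtain q where q: "q \<in> {a<..<p}" "(g ^^ 2) q = q" using sq.interior_fixed_point by blast
    \<comment> \<open>Otherwise \<open>switch\<close> sends \<open>{q..p}\<close> into
      \<open>{a..q}\<close>, although \<open>p\<close> lies to the right of \<open>q\<close> and is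
      fixed by the square.\<close>
    have "\<exists>z\<in>{a<..<p}. z \<noteq> q \<and> (g ^^ 2) z = q"
    proof (rule ccontr)
      assume "\<not> ?thesis"
      then have "(g ^^ 2) ` {q..p} \<subseteq> {a..q}" using sq.switch(2)[OF q] by blast
      moreover have "(g ^^ 2) p = p" using p by (simp add: numeral_2_eq_2)
      moreover have "p \<in> {q..p}" using q(1) by simp
      ultimately have "p \<in> {a..q}" by (metis image_subset_iff)
      then show False using q(1) by simp
    qed
    then obtain z where "z \<in> {a<..<p}" "z \<noteq> q" "((g ^^ 2) ^^ 1) z = q" by auto
    then obtain m A B where m: "m > 0" "horseshoe ((g ^^ 2) ^^ m) A B" "A \<subseteq> {a..p}" "B \<subseteq> {a..p}"
      using sq.horseshoe_homoclinic[of q z 1] q by auto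
    have "horseshoe (g ^^ (2 * m)) A B" "2 * m > 0" using m(1,2) by (auto simp: funpow_mult)
    moreover have "A \<subseteq> {a..b}" "B \<subseteq> {a..b}" using m(3,4) p(1) by fastforce+
    ultimately show ?thesis by blast
  qed
qed

lemma hyper_rate_unbounded_transitive:
  fixes f :: "real \<Rightarrow> real"
  assumes "self_map_on {0..1} f" "nds_transitive {0..1} (\<lambda>_. f)"
  shows "\<exists>\<epsilon>>0. ereal r < entropy_rate (hyperspace {0..1}) (hausdorff_dist dist) (\<lambda>_. hyper_map f) \<epsilon>"
proof -
  have "transitive_interval_map f 0 1" by standard (use assms in auto)
  then obtain m A B where "m > 0" "horseshoe (f ^^ m) A B" "A \<subseteq> {0..1}" "B \<subseteq> {0..1}"
    using transitive_interval_map_horseshoe by metis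
  then show ?thesis
    using hyper_rate_unbounded_horseshoe[of "{0..1}" f m A B r] assms(1) by (auto simp: self_map_on_def)
qed

section \<open>A slow transitive sequence\<close>

text \<open>\<open>g\<close> acts exactly when \<open>Suc n\<close> is a perfect square; in terms of
  jumps of \<open>floor_sqrt\<close>, the number of applications up to time \<open>n\<close>
  telescopes to \<open>floor_sqrt n\<close>.\<close>

definition slow_sequence :: "('a \<Rightarrow> 'a) \<Rightarrow> nat \<Rightarrow> 'a \<Rightarrow> 'a" where
  "slow_sequence g n = (if floor_sqrt (Suc n) = floor_sqrt n then id else g)"

lemma floor_sqrt_Suc_cases: "floor_sqrt (Suc n) = floor_sqrt n \<or> floor_sqrt (Suc n) = Suc (floor_sqrt n)"
proof -
  have "floor_sqrt (Suc n) \<le> floor_sqrt ((Suc (floor_sqrt n))\<^sup>2)"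
    by (rule mono_floor_sqrt'[OF Suc_leI[OF Suc_floor_sqrt_power2_gt]])
  then have "floor_sqrt (Suc n) \<le> Suc (floor_sqrt n)" by simp
  moreover have "floor_sqrt n \<le> floor_sqrt (Suc n)" by (rule mono_floor_sqrt') simp
  ultimately show ?thesis by linarith
qed

lemma nds_iter_slow_sequence: "nds_iter (slow_sequence g) n = g ^^ floor_sqrt n"
proof (induction n)
  case (Suc n)
  show ?case
  proof (cases "floor_sqrt (Suc n) = floor_sqrt n")
    case False
    then have "floor_sqrt (Suc n) = Suc (floor_sqrt n)" using floor_sqrt_Suc_cases by blast
    then show ?thesis using Suc by (simp add: slow_sequence_def)
  qed (use Suc in \<open>simp add: slow_sequence_def\<close>)
qed simp

text \<open>
  Up to time \<open>n\<close> only \<open>floor_sqrt n + 1\<close> distinct maps occur, so that recording the colours of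
  their values distinguishes the points of a separated set.
\<close>

lemma entropy_rate_slow:
  assumes M: "M \<subseteq> M'" and G: "\<And>u. u \<in> M' \<Longrightarrow> G u \<in> M'"
    and iter: "\<And>n u. u \<in> M' \<Longrightarrow> nds_iter f n u = (G ^^ floor_sqrt n) u"
    and C: "finite C" "\<And>u. u \<in> M' \<Longrightarrow> c u \<in> C"
    and col: "\<And>u v. u \<in> M' \<Longrightarrow> v \<in> M' \<Longrightarrow> c u = c v \<Longrightarrow> d u v \<le> \<epsilon>"
  shows "entropy_rate M d f \<epsilon> \<le> 0"
proof -
  \<comment> \<open>The added one ensures \<open>K \<ge> 1\<close>, so that \<open>ln K\<close> is
    nonnegative.\<close>
  define K where "K = real (card C + 1)"
  have Gi: "(G ^^ i) u \<in> M'" if "u \<in> M'" for i u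
    using that G by (induction i) auto
  have "sep_number M d f n \<epsilon> \<le> enat ((card C + 1) ^ Suc (floor_sqrt n))" for n
  proof (rule sep_number_le)
    fix E assume E: "E \<subseteq> M" "finite E" "nds_separated d f n \<epsilon> E"
    let ?\<Phi> = "\<lambda>u. restrict (\<lambda>j. c ((G ^^ j) u)) {..floor_sqrt n}"
    have "inj_on ?\<Phi> E"
    proof (rule inj_onI, rule ccontr)
      fix u v assume uv: "u \<in> E" "v \<in> E" "?\<Phi> u = ?\<Phi> v" "u \<noteq> v"
      then obtain k where k: "k < n" "\<epsilon> < d (nds_iter f k u) (nds_iter f k v)"
        using E(3) unfolding nds_separated_def by blast
      have M': "u \<in> M'" "v \<in> M'" using uv E M by auto
      have "floor_sqrt k \<le> floor_sqrt n" using k(1) by (intro mono_floor_sqrt') simp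
      then have "c ((G ^^ floor_sqrt k) u) = c ((G ^^ floor_sqrt k) v)"
        using fun_cong[OF uv(3), of "floor_sqrt k"] by simp
      then show False using k(2) col[OF Gi[OF M'(1)] Gi[OF M'(2)]] iter[OF M'(1)] iter[OF M'(2)]
        by (simp add: not_less[symmetric])
    qed
    moreover have "?\<Phi> ` E \<subseteq> {..floor_sqrt n} \<rightarrow>\<^sub>E C"
      using C(2) Gi E(1) M by (intro image_subsetI restrict_PiE_iff[THEN iffD2]) blast
    ultimately have "card E \<le> card ({..floor_sqrt n} \<rightarrow>\<^sub>E C)"
      using C by (intro card_inj_on_le[of ?\<Phi>] finite_PiE) auto
    also have "\<dots> = card C ^ Suc (floor_sqrt n)" by (simp add: card_PiE)
    also have "\<dots> \<le> (card C + 1) ^ Suc (floor_sqrt n)" by (intro power_mono) auto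
    finally show "enat (card E) \<le> enat ((card C + 1) ^ Suc (floor_sqrt n))" by simp
  qed
  then have "ln_enat (sep_number M d f n \<epsilon>) \<le> ln_enat (enat ((card C + 1) ^ Suc (floor_sqrt n)))" for n
    by (intro ln_enat_mono)
  moreover have "ln_enat (enat ((card C + 1) ^ Suc (floor_sqrt n))) \<le> ereal ((sqrt n + 1) * ln K)" for n
  proof -
    have "real (floor_sqrt n) \<le> sqrt n"
      by (rule real_le_rsqrt) (metis floor_sqrt_power2_le of_nat_le_iff of_nat_power)
    then have "real (Suc (floor_sqrt n)) * ln K \<le> (sqrt n + 1) * ln K"
      by (intro mult_right_mono) (auto simp: K_def)
    moreover have "ln (real ((card C + 1) ^ Suc (floor_sqrt n))) = real (Suc (floor_sqrt n)) * ln K"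
      unfolding of_nat_power K_def by (rule ln_realpow)
    ultimately show ?thesis by (simp add: ln_enat_def)
  qed
  ultimately have "ereal (1 / real n) * ln_enat (sep_number M d f n \<epsilon>)
      \<le> ereal (1 / real n) * ereal ((sqrt n + 1) * ln K)" for n
    by (intro ereal_mult_left_mono) (auto intro: order_trans)
  then have "entropy_rate M d f \<epsilon> \<le> limsup (\<lambda>n. ereal (1 / real n) * ereal ((sqrt n + 1) * ln K))"
    unfolding entropy_rate_def by (intro Limsup_mono always_eventually allI)
  also have "\<dots> = 0"
  proof (rule lim_imp_Limsup)
    have "(\<lambda>n. 1 / real n * (sqrt n + 1)) \<longlonglongrightarrow> 0" by real_asymp
    from tendsto_mult_right[OF this, of "ln K"]
    have "(\<lambda>n. 1 / real n * ((sqrt n + 1) * ln K)) \<longlonglongrightarrow> 0" by (simp add: mult.assoc)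
    then show "(\<lambda>n. ereal (1 / real n) * ereal ((sqrt n + 1) * ln K)) \<longlonglongrightarrow> 0"
      by (simp add: zero_ereal_def)
  qed simp
  finally show ?thesis .
qed

section \<open>Finitely many colours for fuzzy sets\<close>

definition grid_colour :: "nat \<Rightarrow> (real \<Rightarrow> real) \<Rightarrow> bool \<times> (int \<times> int) set" where
  "grid_colour N u = (fuzzy_empty {0..1} u,
     (\<lambda>(x, a). (\<lfloor>real N * x\<rfloor>, \<lfloor>real N * a\<rfloor>)) ` endograph {0..1} u)"

lemma grid_colour_in: "grid_colour N u \<in> UNIV \<times> Pow ({0..int N} \<times> {0..int N})"
proof -
  have "\<lfloor>real N * x\<rfloor> \<in> {0..int N}" if "x \<in> {0..1}" for x
  proof -
    have "real N * x \<le> real N" using that by (simp add: mult_left_le)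
    then show ?thesis using that by (auto simp: floor_le_iff)
  qed
  then show ?thesis by (auto simp: grid_colour_def endograph_def)
qed

text \<open>The colour records which grid cells of side \<open>1 / N\<close> the endograph meets, so
  every point of one endograph has a partner in its own cell. The emptiness flag excludes the case
  of exactly one empty fuzzy set, which \<open>endo_dist\<close> measures by another rule.\<close>

lemma endo_dist_le_grid_colour:
  assumes uv: "u \<in> {0..1} \<rightarrow> {0..1}" "v \<in> {0..1} \<rightarrow> {0..1}"
    and "grid_colour N u = grid_colour N v" "N > 0"
  shows "endo_dist {0..1} u v \<le> 1 / N"
proof -
  let ?q = "\<lambda>(x, a). (\<lfloor>real N * x\<rfloor>, \<lfloor>real N * a\<rfloor>)"
  have near: "max_dist p p' \<le> 1 / N" if "?q p = ?q p'" for p p'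
  proof -
    have "dist x y \<le> 1 / N" if "\<lfloor>real N * x\<rfloor> = \<lfloor>real N * y\<rfloor>" for x y
    proof -
      have "\<bar>real N * x - real N * y\<bar> < 1" using that by linarith
      then have "real N * \<bar>x - y\<bar> < 1" by (simp add: abs_mult flip: right_diff_distrib)
      then show ?thesis using \<open>N > 0\<close> by (simp add: dist_real_def field_simps)
    qed
    then show ?thesis using that by (auto simp: max_dist_def split: prod.splits)
  qed
  have ne: "endograph {0..1} w \<noteq> {}" if "w \<in> {0..1} \<rightarrow> {0..1}" for w :: "real \<Rightarrow> real"
  proof -
    have "(0, 0) \<in> endograph {0..1} w" using funcset_mem[OF that, of 0] by (auto simp: endograph_def)
    then show ?thesis by blast
  qed
  have img: "?q ` endograph {0..1} u = ?q ` endograph {0..1} v"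
    and emp: "fuzzy_empty {0..1} u = fuzzy_empty {0..1} v"
    using assms(3) by (auto simp: grid_colour_def)
  have "hausdorff_dist max_dist (endograph {0..1} u) (endograph {0..1} v) \<le> 1 / N"
  proof (rule hausdorff_dist_le)
    fix p assume "p \<in> endograph {0..1} u"
    then have "?q p \<in> ?q ` endograph {0..1} v" using img by blast
    then show "\<exists>p'\<in>endograph {0..1} v. max_dist p p' \<le> 1 / N" using near by (metis (no_types, lifting) imageE)
  next
    fix p assume "p \<in> endograph {0..1} v"
    then have "?q p \<in> ?q ` endograph {0..1} u" using img by blast
    then show "\<exists>p'\<in>endograph {0..1} u. max_dist p' p \<le> 1 / N" using near by (metis (no_types, lifting) imageE)
  qed (use ne uv in \<open>auto simp: max_dist_def le_max_iff_disj\<close>)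
  then show ?thesis using emp by (auto simp: endo_dist_def)
qed

lemma fuzzy_map_in:
  assumes "u \<in> X \<rightarrow>\<^sub>E {0..1}"
  shows "fuzzy_map X g u \<in> X \<rightarrow>\<^sub>E {0..1}"
proof -
  have "(SUP z\<in>{z \<in> X. g z = x}. u z) \<in> {0..1}" if "z \<in> X" "g z = x" for x z
  proof -
    have "u z \<le> (SUP z\<in>{z \<in> X. g z = x}. u z)"
      using that assms by (intro cSUP_upper bdd_aboveI2[of _ _ 1]) auto
    moreover have "(SUP z\<in>{z \<in> X. g z = x}. u z) \<le> 1"
      using that assms by (intro cSUP_least) auto
    moreover have "0 \<le> u z" using that assms by auto
    ultimately show ?thesis by simp
  qed
  then show ?thesis by (auto simp: fuzzy_map_def)
qed

lemma fuzzy_map_id: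
  assumes "u \<in> X \<rightarrow>\<^sub>E {0..1}"
  shows "fuzzy_map X id u = u"
proof
  fix x
  have "{z \<in> X. id z = x} = {x}" if "x \<in> X" using that by auto
  then show "fuzzy_map X id u x = u x"
    using assms by (auto simp: fuzzy_map_def PiE_def extensional_def)
qed

text \<open>Unlike for the base maps, the idle steps are identities only on functions
  \<open>undefined\<close> off \<open>X\<close>, so membership in that set is carried along.\<close>

lemma nds_iter_fuzzy_slow_sequence:
  assumes "u \<in> X \<rightarrow>\<^sub>E {0..1}"
  shows "nds_iter (\<lambda>n. fuzzy_map X (slow_sequence g n)) n u = (fuzzy_map X g ^^ floor_sqrt n) u"
proof (induction n)
  case (Suc n)
  have inv: "(fuzzy_map X g ^^ k) u \<in> X \<rightarrow>\<^sub>E {0..1}" for k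
    by (induction k) (simp_all only: funpow.simps id_apply o_apply assms fuzzy_map_in)
  show ?case
  proof (cases "floor_sqrt (Suc n) = floor_sqrt n")
    case True
    then show ?thesis using Suc by (simp add: slow_sequence_def fuzzy_map_id[OF inv])
  next
    case False
    then have "floor_sqrt (Suc n) = Suc (floor_sqrt n)" using floor_sqrt_Suc_cases by blast
    then show ?thesis using Suc by (simp add: slow_sequence_def)
  qed
qed simp

lemma fuzzy_rate_slow_sequence:
  assumes "0 < \<epsilon>"
  shows "entropy_rate (fuzzy_sets {0..1}) (endo_dist {0..1})
    (\<lambda>n. fuzzy_map {0..1::real} (slow_sequence g n)) \<epsilon> \<le> 0"
proof -
  obtain N where N: "N > 0" "1 / real N < \<epsilon>"
    using nat_approx_posE[OF assms] by (metis zero_less_Suc)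
  show ?thesis
  \<comment> \<open>Orbits are followed among all functions into the unit interval, where invariance
    is just a bound on suprema.\<close>
  proof (rule entropy_rate_slow[where M' = "{0..1} \<rightarrow>\<^sub>E {0..1}" and G = "fuzzy_map {0..1} g" and c = "grid_colour N"])
    show "endo_dist {0..1} u v \<le> \<epsilon>"
      if "u \<in> {0..1} \<rightarrow>\<^sub>E {0..1}" "v \<in> {0..1} \<rightarrow>\<^sub>E {0..1}" "grid_colour N u = grid_colour N v" for u v
    proof -
      have "u \<in> {0..1} \<rightarrow> {0..1}" "v \<in> {0..1} \<rightarrow> {0..1}" using that by auto
      then show ?thesis using endo_dist_le_grid_colour[OF _ _ that(3) N(1)] N(2) by force
    qed
    show "finite (UNIV \<times> Pow ({0..int N} \<times> {0..int N}) :: (bool \<times> (int \<times> int) set) set)" by simp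
    show "fuzzy_sets {0..1} \<subseteq> {0..1} \<rightarrow>\<^sub>E {0..1}" by (auto simp: fuzzy_sets_def)
  qed (rule fuzzy_map_in nds_iter_fuzzy_slow_sequence grid_colour_in; assumption?)+
qed

text \<open>The Chebyshev map \<open>x \<mapsto> 2 x\<^sup>2 - 1\<close> of \<open>[-1, 1]\<close>, transported to \<open>[0, 1]\<close>.\<close>

definition chebyshev :: "real \<Rightarrow> real" where
  "chebyshev x = (2 * x - 1)\<^sup>2"

text \<open>The map \<theta> \<mapsto> (1 + cos \<theta>) / 2 semiconjugates angle doubling to
  \<open>chebyshev\<close>.\<close>

lemma chebyshev_cos: "(chebyshev ^^ n) ((1 + cos \<theta>) / 2) = (1 + cos (2 ^ n * \<theta>)) / 2"
proof (induction n)
  case (Suc n)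
  then show ?case using cos_double_cos[of "2 ^ n * \<theta>"]
    by (simp add: chebyshev_def mult.assoc field_simps)
qed simp

lemma chebyshev_self_map: "self_map_on {0..1} chebyshev"
proof -
  have "(2 * x - 1)\<^sup>2 \<le> 1" if "x \<in> {0..1}" for x :: real
    using that by (auto simp: abs_square_le_1 abs_le_iff)
  then show ?thesis unfolding self_map_on_def chebyshev_def by (auto intro!: continuous_intros)
qed

text \<open>Lifted to angles, \<open>U\<close> contains an interval, which repeated doubling
  stretches beyond a full period; its image then meets every value.\<close>

lemma chebyshev_expanding:
  assumes "openin (top_of_set {0..1}) U" "U \<noteq> {}" "y \<in> {0..1}"
  obtains n x where "n \<ge> 1" "x \<in> U" "(chebyshev ^^ n) x = y"
proof -
  let ?h = "\<lambda>\<theta>::real. (1 + cos \<theta>) / 2"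
  have h: "\<exists>\<theta>. ?h \<theta> = x" if "x \<in> {0..1}" for x
    using that by (intro exI[of _ "arccos (2 * x - 1)"]) auto
  have h01: "?h \<theta> \<in> {0..1}" for \<theta>
  proof -
    have "(1 + c) / 2 \<in> {0..1}" if "-1 \<le> c" "c \<le> 1" for c :: real
      using that by simp
    then show ?thesis using cos_ge_minus_one cos_le_one by blast
  qed
  obtain T where T: "open T" "U = {0..1} \<inter> T" using assms(1) by (auto simp: openin_open)
  obtain x where "x \<in> U" using assms(2) by blast
  then obtain \<theta> where \<theta>: "?h \<theta> \<in> T" using h T(2) by (metis IntD1 IntD2)
  have "open (?h -` T)" using T(1) by (intro open_vimage continuous_intros) auto
  then obtain e where e: "e > 0" "ball \<theta> e \<subseteq> ?h -` T"
    using \<theta> by (meson open_contains_ball vimageI)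
  obtain \<phi> where \<phi>: "?h \<phi> = y" using h assms(3) by blast
  obtain n where n: "2 * pi / e < 2 ^ n" using real_arch_pow[of 2 "2 * pi / e"] by auto
  \<comment> \<open>Replacing \<open>n\<close> by \<open>Suc n\<close> guarantees at least one
    step.\<close>
  have "(2::real) ^ n \<le> 2 ^ Suc n" by simp
  with n have n: "2 * pi / e < 2 ^ Suc n" by linarith
  \<comment> \<open>The translate \<phi> + 2 pi j is the last one not exceeding
    \<open>2 ^ Suc n * \<theta>\<close>; dividing by \<open>2 ^ Suc n\<close> puts it within
    \<open>e\<close> of \<theta>.\<close>
  define j where "j = \<lfloor>(2 ^ Suc n * \<theta> - \<phi>) / (2 * pi)\<rfloor>"
  define \<theta>' where "\<theta>' = (\<phi> + 2 * pi * of_int j) / 2 ^ Suc n"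
  have "0 \<le> (2 ^ Suc n * \<theta> - \<phi>) / (2 * pi) - of_int j" "(2 ^ Suc n * \<theta> - \<phi>) / (2 * pi) - of_int j < 1"
    unfolding j_def by linarith+
  then have "0 \<le> 2 ^ Suc n * \<theta> - \<phi> - 2 * pi * of_int j" "2 ^ Suc n * \<theta> - \<phi> - 2 * pi * of_int j < 2 * pi"
    by (simp_all add: field_simps)
  moreover have "2 ^ Suc n * (\<theta> - \<theta>') = 2 ^ Suc n * \<theta> - \<phi> - 2 * pi * of_int j"
    by (simp add: \<theta>'_def right_diff_distrib)
  moreover have "2 * pi < 2 ^ Suc n * e" using n e(1) by (simp add: pos_divide_less_eq)
  ultimately have "0 \<le> 2 ^ Suc n * (\<theta> - \<theta>')" "2 ^ Suc n * (\<theta> - \<theta>') < 2 ^ Suc n * e" by linarith+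
  then have "0 \<le> \<theta> - \<theta>'" "\<theta> - \<theta>' < e"
    by (simp_all only: zero_le_mult_iff mult_less_cancel_left_pos zero_less_power zero_less_numeral)
       (smt (verit) zero_less_power)
  then have "\<theta>' \<in> ball \<theta> e" by (simp add: dist_real_def)
  then have "?h \<theta>' \<in> U" using e(2) T(2) h01 by auto
  moreover have "(chebyshev ^^ Suc n) (?h \<theta>') = y"
  proof -
    have "(chebyshev ^^ Suc n) (?h \<theta>') = ?h (2 ^ Suc n * \<theta>')" by (rule chebyshev_cos)
    also have "2 ^ Suc n * \<theta>' = \<phi> + 2 * pi * of_int j" by (simp add: \<theta>'_def)
    also have "cos \<dots> = cos \<phi>" by (simp add: cos_add cos_int_2pin sin_int_2pin)
    finally show ?thesis using \<phi> by simp
  qed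
  ultimately show ?thesis using that[of "Suc n" "?h \<theta>'"] by simp
qed

text \<open>The slow iterate at time \<open>n\<^sup>2\<close> is the \<open>n\<close>-th iterate of
  \<open>chebyshev\<close>, so visits are delayed but none is lost.\<close>

lemma nds_transitive_slow_chebyshev: "nds_transitive {0..1} (slow_sequence chebyshev)"
  unfolding nds_transitive_def
proof (intro allI impI, elim conjE)
  fix U V :: "real set"
  assume U: "openin (top_of_set {0..1}) U" "U \<noteq> {}" and V: "openin (top_of_set {0..1}) V" "V \<noteq> {}"
  obtain y where y: "y \<in> V" "y \<in> {0..1}" using V openin_imp_subset by blast
  obtain n x where n: "n \<ge> 1" "x \<in> U" "(chebyshev ^^ n) x = y"
    using chebyshev_expanding[OF U y(2)] .
  have "nds_iter (slow_sequence chebyshev) (n\<^sup>2) x = y" using n by (simp add: nds_iter_slow_sequence)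
  moreover have "n\<^sup>2 \<ge> 1" using n(1) by simp
  ultimately show "\<exists>n\<ge>1. nds_iter (slow_sequence chebyshev) n ` U \<inter> V \<noteq> {}"
    using n(2) y(1) by blast
qed

section \<open>Entropies of the two induced systems\<close>

theorem theorem2p10:
  shows "(\<forall>f :: real \<Rightarrow> real.
            self_map_on {0..1} f \<and> nds_transitive {0..1} (\<lambda>_. f) \<longrightarrow>
              fuzzy_entropy {0..1} (\<lambda>_. f) = \<infinity> \<and> hyper_entropy {0..1} (\<lambda>_. f) = \<infinity>)
       \<and> (\<exists>f :: nat \<Rightarrow> real \<Rightarrow> real.
            (\<forall>n. self_map_on {0..1} (f n)) \<and> nds_transitive {0..1} f \<and>
              fuzzy_entropy {0..1} f = 0 \<and> hyper_entropy {0..1} f = 0)"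
proof (intro conjI allI impI exI[of _ "slow_sequence chebyshev"])
  fix f :: "real \<Rightarrow> real"
  assume f: "self_map_on {0..1} f \<and> nds_transitive {0..1} (\<lambda>_. f)"
  then show "hyper_entropy {0..1} (\<lambda>_. f) = \<infinity>"
    unfolding hyper_entropy_def by (intro nds_entropy_eq_infinity hyper_rate_unbounded_transitive) auto
  have "f \<in> {0..1} \<rightarrow> {0..1}" using f by (auto simp: self_map_on_def)
  then show "fuzzy_entropy {0..1} (\<lambda>_. f) = \<infinity>"
    unfolding fuzzy_entropy_def using f hyper_rate_unbounded_transitive hyper_rate_le_fuzzy_rate[of "\<lambda>_. f"]
    by (intro nds_entropy_eq_infinity) (meson less_le_trans)
next
  show maps: "self_map_on {0..1} (slow_sequence chebyshev n)" for n
    using chebyshev_self_map by (auto simp: slow_sequence_def self_map_on_def)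
  show "nds_transitive {0..1} (slow_sequence chebyshev)" by (rule nds_transitive_slow_chebyshev)
  show "fuzzy_entropy {0..1} (slow_sequence chebyshev) = 0"
    unfolding fuzzy_entropy_def by (intro nds_entropy_eq_0 fuzzy_rate_slow_sequence)
  have "slow_sequence chebyshev n \<in> {0..1} \<rightarrow> {0..1}" for n
    using maps by (auto simp: self_map_on_def)
  then show "hyper_entropy {0..1} (slow_sequence chebyshev) = 0"
    unfolding hyper_entropy_def
    \<comment> \<open>At each scale the hyperspace rate lies below the fuzzy rate, which is at most
      0.\<close>
    by (intro nds_entropy_eq_0 order_trans[OF hyper_rate_le_fuzzy_rate fuzzy_rate_slow_sequence])
qed

end
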